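(* Let $m\geq 33$ be an integer and let $G$ be an $H_{7}$-free graph with exactly $m$ edges and no isolated vertices, where $H_7 = K_1\vee P_6$. Then $$\rho(G)\leq 1+\sqrt{m-2},$$ and equality holds if and only if $G\cong K_3 \vee \frac{m-3}{3}K_1$.
   Context: All graphs are finite, undirected and simple. The size of a graph $G$ is its number of edges $m=|E(G)|$. The spectral radius $\rho(G)$ is the largest eigenvalue of the adjacency matrix $A(G)$ of $G$. $P_n$ and $K_n$ denote the path and the complete graph on $n$ vertices. For vertex-disjoint graphs $G$ and $H$, the join $G\vee H$ is obtained from the disjoint union of $G$ and $H$ by adding all edges between every vertex of $G$ and every vertex of $H$; $kG$ denotes the disjoint union of $k$ copies of $G$ (so $kK_1$ is the graph with $k$ vertices and no edges). The fan graph $H_7 = K_1\vee P_6$ is the $7$-vertex graph consisting of a $6$-vertex path plus one further vertex adjacent to every vertex of the path. A graph is $H$-free if it does not contain $H$ as a (not necessarily induced) subgraph. The graph $K_3\vee\frac{m-3}{3}K_1$ (a triangle joined to $\frac{m-3}{3}$ isolated vertices) has $m$ edges and is defined only when $3$ divides $m$; when $3\nmid m$, the condition $G\cong K_3 \vee \frac{m-3}{3}K_1$ is understood to be satisfied by no graph $G$. *)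

theory Defs
  imports
    Complex_Main
    "Graph_Theory.Pair_Digraph"
    "Graph_Theory.Digraph_Isomorphism"
    "Jordan_Normal_Form.Spectral_Radius"
begin

text \<open>
  A finite simple undirected graph is a \<^locale>\<open>pair_graph\<close>: a finite vertex set with a symmetric,
  irreflexive set of arcs. Each undirected edge \<open>uv\<close> is represented by the two arcs \<open>(u, v)\<close> and
  \<open>(v, u)\<close>, so edges have to be counted as unordered pairs.
\<close>

definition edges :: "'a pair_pre_digraph \<Rightarrow> 'a set set" where
  "edges G = (\<lambda>(u, v). {u, v}) ` parcs G"

definition graph_size :: "'a pair_pre_digraph \<Rightarrow> nat" where
  "graph_size G = card (edges G)"

definition no_isolated_vertices :: "'a pair_pre_digraph \<Rightarrow> bool" where
  "no_isolated_vertices G \<longleftrightarrow> (\<forall>v \<in> pverts G. \<exists>w. (v, w) \<in> parcs G)"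

definition graph_iso :: "'a pair_pre_digraph \<Rightarrow> 'b pair_pre_digraph \<Rightarrow> bool" where
  "graph_iso G H \<longleftrightarrow> digraph_iso (with_proj G) (with_proj H)"

definition contains_graph :: "'a pair_pre_digraph \<Rightarrow> 'b pair_pre_digraph \<Rightarrow> bool" where
  "contains_graph G H \<longleftrightarrow> (\<exists>S. subgraph (with_proj S) (with_proj G) \<and> graph_iso H S)"

definition free_of :: "'b pair_pre_digraph \<Rightarrow> 'a pair_pre_digraph \<Rightarrow> bool" where
  "free_of H G \<longleftrightarrow> \<not> contains_graph G H"

definition path_graph :: "nat \<Rightarrow> nat pair_pre_digraph" where
  "path_graph n = \<lparr> pverts = {..<n},
     parcs = {(i, j). i < n \<and> j < n \<and> (j = Suc i \<or> i = Suc j)} \<rparr>"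

definition complete_graph :: "nat \<Rightarrow> nat pair_pre_digraph" where
  "complete_graph n = \<lparr> pverts = {..<n}, parcs = {(i, j). i < n \<and> j < n \<and> i \<noteq> j} \<rparr>"

definition graph_join :: "'a pair_pre_digraph \<Rightarrow> 'b pair_pre_digraph \<Rightarrow> ('a + 'b) pair_pre_digraph"
where
  "graph_join G H = \<lparr> pverts = pverts G <+> pverts H,
     parcs = map_prod Inl Inl ` parcs G \<union> map_prod Inr Inr ` parcs H
           \<union> (Inl ` pverts G) \<times> (Inr ` pverts H) \<union> (Inr ` pverts H) \<times> (Inl ` pverts G) \<rparr>"

definition graph_copies :: "nat \<Rightarrow> 'a pair_pre_digraph \<Rightarrow> (nat \<times> 'a) pair_pre_digraph" where
  "graph_copies k G = \<lparr> pverts = {..<k} \<times> pverts G,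
     parcs = {((i, u), (j, v)). i < k \<and> j = i \<and> (u, v) \<in> parcs G} \<rparr>"

definition fan7 :: "(nat + nat) pair_pre_digraph" where
  "fan7 = graph_join (complete_graph 1) (path_graph 6)"

text \<open>
  Matrices of \<^theory>\<open>Jordan_Normal_Form.Matrix\<close> are indexed by \<open>0, \<dots>, n - 1\<close>, so the vertices
  are listed in an arbitrary but fixed order. Another order gives a permutation-similar matrix,
  which has the same eigenvalues.
\<close>

definition vertex_list :: "'a pair_pre_digraph \<Rightarrow> 'a list" where
  "vertex_list G = (SOME vs. distinct vs \<and> set vs = pverts G)"

definition adjacency_matrix :: "'a pair_pre_digraph \<Rightarrow> real mat" where
  "adjacency_matrix G = (let vs = vertex_list G; n = length vs in
     mat n n (\<lambda>(i, j). if (vs ! i, vs ! j) \<in> parcs G then 1 else 0))"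

text \<open>
  The adjacency matrix is real symmetric, so its eigenvalues are all real; the maximum is taken over
  a finite set that is nonempty as soon as the graph has a vertex. This is not the library constant
  \<^const>\<open>spectral_radius\<close>, which is the maximal modulus of the eigenvalues of a complex matrix.
\<close>

definition graph_spectral_radius :: "'a pair_pre_digraph \<Rightarrow> real" where
  "graph_spectral_radius G = Max (spectrum (adjacency_matrix G))"

end

theory Submission
  imports Defs
begin

text \<open>
  Suppose \<open>\<rho> \<ge> 1 + sqrt (m - 2)\<close>, so that \<open>\<rho>\<^sup>2 - 2 \<rho> \<ge> m - 3\<close> and \<open>\<rho> > 13/2\<close>. Take a nonnegative
  eigenvector \<open>x\<close> with maximal entry \<open>x u = 1\<close>, let \<open>N\<close> be the neighbourhood of \<open>u\<close> and \<open>W\<close> the set of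
  remaining vertices. Evaluating \<open>A\<^sup>2 x - 2 A x\<close> at \<open>u\<close> and comparing with
  \<open>m = |N| + e(N) + e(N, W) + e(W)\<close> gives
  \<open>\<Sum>v\<in>N. (d\<^sub>N v - 2) x v - e(N) + 3 \<ge> e(W) + \<Sum>w\<in>W. d\<^sub>N w (1 - x w) \<ge> 0\<close>.
  As \<open>N\<close> induces a graph without \<open>P\<^sub>6\<close>, peeling off vertices of degree at most 2 and closed sets of 4 or
  5 vertices bounds the left-hand side by \<open>0\<close>, unless \<open>N\<close> contains five vertices spanning at least nine
  edges. Such a set is a component of \<open>N\<close>; to carry enough weight it needs many neighbours
  \<open>w\<close> in \<open>W\<close> with \<open>x w\<close> large, but each of these misses so much of \<open>N\<close>, by fan-freeness, that
  \<open>\<Sum>w\<in>W. d\<^sub>N w (1 - x w)\<close> becomes too large. So equality holds throughout, and this forces \<open>W = {}\<close> and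
  exactly two vertices of \<open>N\<close> adjacent to all of \<open>N\<close>, with no further edges.
\<close>

subsection \<open>Graphs without a path on six vertices\<close>

locale simple_adj =
  fixes adj :: "'a \<Rightarrow> 'a \<Rightarrow> bool"
  assumes adj_sym: "adj u v \<Longrightarrow> adj v u"
    and adj_irrefl: "\<not> adj u u"
begin

text \<open>\<open>v\<close> may lie outside \<open>S\<close>, so the same function counts edges
  between disjoint sets.\<close>

definition deg :: "'a set \<Rightarrow> 'a \<Rightarrow> nat" where
  "deg S v = card {u \<in> S. adj v u}"

text \<open>Twice the number of edges inside \<open>S\<close>; the doubled value avoids division in
  \<open>nat\<close>.\<close>

definition deg_sum :: "'a set \<Rightarrow> nat" where
  "deg_sum S = (\<Sum>v\<in>S. deg S v)"

definition P6_free :: "'a set \<Rightarrow> bool" where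
  "P6_free S \<longleftrightarrow> (\<forall>a b c d e f. {a, b, c, d, e, f} \<subseteq> S \<longrightarrow> distinct [a, b, c, d, e, f] \<longrightarrow>
     adj a b \<longrightarrow> adj b c \<longrightarrow> adj c d \<longrightarrow> adj d e \<longrightarrow> \<not> adj e f)"

text \<open>A union of connected components of the graph induced on \<open>S\<close>.\<close>

definition closed_in :: "'a set \<Rightarrow> 'a set \<Rightarrow> bool" where
  "closed_in S D \<longleftrightarrow> D \<subseteq> S \<and> (\<forall>p\<in>D. \<forall>q\<in>S - D. \<not> adj p q)"

text \<open>Nine edges counted twice, so \<open>K_5\<close> or \<open>K_5\<close> minus one
  edge.\<close>

definition dense5 :: "'a set \<Rightarrow> bool" where
  "dense5 D \<longleftrightarrow> card D = 5 \<and> 18 \<le> deg_sum D"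

lemma adj_commute: "adj u v \<longleftrightarrow> adj v u"
  using adj_sym by blast

lemma P6_freeD:
  assumes "P6_free S" "{a, b, c, d, e, f} \<subseteq> S" "distinct [a, b, c, d, e, f]"
    "adj a b" "adj b c" "adj c d" "adj d e" "adj e f"
  shows False
  using assms unfolding P6_free_def by (elim allE[of _ a] allE[of _ b] allE[of _ c] allE[of _ d]
      allE[of _ e] allE[of _ f]) simp

lemma P6_free_mono: "P6_free S \<Longrightarrow> D \<subseteq> S \<Longrightarrow> P6_free D"
  unfolding P6_free_def by (meson subset_trans)

lemma deg_conv_sum: "finite S \<Longrightarrow> deg S v = (\<Sum>u\<in>S. of_bool (adj v u))"
  by (simp add: deg_def Int_def)

lemma deg_Un:
  assumes "finite A" "finite B" "A \<inter> B = {}"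
  shows "deg (A \<union> B) v = deg A v + deg B v"
  using assms by (simp add: deg_conv_sum sum.union_disjoint del: sum_of_bool_eq)

lemma deg_swap:
  assumes "finite A" "finite B"
  shows "(\<Sum>a\<in>A. deg B a) = (\<Sum>b\<in>B. deg A b)"
  using assms sum.swap[of "\<lambda>a b. of_bool (adj a b)" B A]
  by (simp add: deg_conv_sum adj_commute del: sum_of_bool_eq)

lemma deg_sum_Un:
  assumes "finite A" "finite B" "A \<inter> B = {}"
  shows "deg_sum (A \<union> B) = deg_sum A + deg_sum B + 2 * (\<Sum>a\<in>A. deg B a)"
  using assms deg_swap[of A B]
  by (simp add: deg_sum_def sum.union_disjoint deg_Un sum.distrib)

lemma deg_sum_remove:
  assumes "finite S" "v \<in> S"
  shows "deg_sum S = deg_sum (S - {v}) + 2 * deg S v"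
proof -
  have "deg {v} v = 0" by (simp add: deg_def adj_irrefl)
  moreover have "deg S v = deg {v} v + deg (S - {v}) v"
    using assms deg_Un[of "{v}" "S - {v}" v] by (simp add: insert_absorb)
  ultimately show ?thesis
    using assms deg_sum_Un[of "{v}" "S - {v}"] by (simp add: insert_absorb deg_sum_def)
qed

lemma deg_sum_closed:
  assumes "finite S" "closed_in S D"
  shows "deg_sum S = deg_sum D + deg_sum (S - D)"
proof -
  have D: "D \<subseteq> S" using assms by (simp add: closed_in_def)
  have "deg (S - D) a = 0" if "a \<in> D" for a
    using that assms by (auto simp: closed_in_def deg_def)
  then show ?thesis
    using D assms(1) deg_sum_Un[of D "S - D"] finite_subset[OF D]
    by (simp add: Un_absorb1 Diff_disjoint)
qed

lemma deg_le_card_minus_1: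
  assumes "finite S" "v \<in> S"
  shows "deg S v \<le> card S - 1"
proof -
  have "{u \<in> S. adj v u} \<subseteq> S - {v}" by (auto simp: adj_irrefl)
  then show ?thesis using assms card_mono[of "S - {v}"] by (simp add: deg_def)
qed

lemma deg_sum_le:
  assumes "finite S"
  shows "deg_sum S \<le> card S * (card S - 1)"
  unfolding deg_sum_def using sum_bounded_above[of S "deg S" "card S - 1"] deg_le_card_minus_1[OF assms]
  by simp

section \<open>Five-vertex sets with many edges\<close>

lemma deg_sum_5:
  assumes "distinct [p, a, b, c, d]"
  shows "deg_sum {p, a, b, c, d} = 2 * (of_bool (adj p a) + of_bool (adj p b) + of_bool (adj p c)
    + of_bool (adj p d) + of_bool (adj a b) + of_bool (adj a c) + of_bool (adj a d)
    + of_bool (adj b c) + of_bool (adj b d) + of_bool (adj c d))"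
proof -
  define n where "n u v = (of_bool (adj u v) :: nat)" for u v
  have n_sym: "n u v = n v u" and n_refl: "n u u = 0" for u v
    by (simp_all add: n_def adj_commute adj_irrefl)
  have deg_D: "deg {p, a, b, c, d} v = n v p + n v a + n v b + n v c + n v d" for v
    using assms by (simp add: deg_conv_sum n_def del: sum_of_bool_eq)
  have "deg_sum {p, a, b, c, d} = deg {p, a, b, c, d} p + deg {p, a, b, c, d} a
      + deg {p, a, b, c, d} b + deg {p, a, b, c, d} c + deg {p, a, b, c, d} d"
    using assms unfolding deg_sum_def by simp
  then have "deg_sum {p, a, b, c, d} = 2 * (n p a + n p b + n p c + n p d + n a b + n a c + n a d
      + n b c + n b d + n c d)"
    unfolding deg_D n_refl n_sym[of a p] n_sym[of b p] n_sym[of c p] n_sym[of d p]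
      n_sym[of b a] n_sym[of c a] n_sym[of d a] n_sym[of c b] n_sym[of d b] n_sym[of d c]
    by simp
  then show ?thesis unfolding n_def .
qed

text \<open>At most two of the ten edges are missing.\<close>

lemma hamiltonian_path_card5:
  assumes D: "card D = 5" "16 \<le> deg_sum D" and p: "p \<in> D"
  obtains q r s t where "D = {p, q, r, s, t}" "distinct [p, q, r, s, t]"
    "adj p q" "adj q r" "adj r s" "adj s t"
proof -
  note goal = that
  have le1: "of_bool P \<le> (1 :: nat)" for P by simp
  have half: "16 \<le> 2 * x \<Longrightarrow> 8 \<le> x" for x :: nat by simp
  have fin: "finite D" using D(1) by (simp add: card_ge_0_finite)
  have enum: "8 \<le> (of_bool (adj p a) + of_bool (adj p b) + of_bool (adj p c)
    + of_bool (adj p d) + of_bool (adj a b) + of_bool (adj a c) + of_bool (adj a d)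
    + of_bool (adj b c) + of_bool (adj b d) + of_bool (adj c d) :: nat)"
    if "D = {p, a, b, c, d}" "distinct [p, a, b, c, d]" for a b c d
    using D(2) unfolding that(1) deg_sum_5[OF that(2)]
    by (rule half)
  have path: thesis if "D = {p, a, b, c, d}" "distinct [p, a, b, c, d]"
    "adj p q \<and> adj q r \<and> adj r s \<and> adj s t" "{q, r, s, t} = {a, b, c, d}" "distinct [q, r, s, t]"
    for a b c d q r s t
  proof (rule goal[of q r s t])
    show "D = {p, q, r, s, t}" using that(1,4) by simp
    have "p \<notin> {q, r, s, t}" using that(2) unfolding that(4) by simp
    then show "distinct [p, q, r, s, t]" using that(5) by simp
  qed (use that(3) in auto)
  \<comment> \<open>The split is by how many of the at most two missing edges meet
    \<open>p\<close>.\<close>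
  consider (all) "\<forall>u\<in>D - {p}. adj p u"
    | (one) a where "a \<in> D - {p}" "\<not> adj p a" "\<forall>u\<in>D - {p, a}. adj p u"
    | (two) a b where "a \<in> D - {p}" "\<not> adj p a" "b \<in> D - {p, a}" "\<not> adj p b"
    by blast
  then show thesis
  proof cases
    case all
    have "card (D - {p}) = 4" using D p fin by simp
    then obtain a b c d where "D - {p} = {a, b, c, d}" and dist: "distinct [a, b, c, d]"
      by (auto simp: card_Suc_eq numeral_eq_Suc)
    then have D_eq: "D = {p, a, b, c, d}" and dist': "distinct [p, a, b, c, d]"
      and adj: "adj p a" "adj p b" "adj p c" "adj p d"
      using p all by auto
    \<comment> \<open>The twelve Hamiltonian paths of a complete graph on \<open>a\<close>,
      \<open>b\<close>, \<open>c\<close>, \<open>d\<close>, each up to reversal. Two missing edges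
      cannot destroy all of them.\<close>
    have "adj a b \<and> adj b c \<and> adj c d \<or> adj a b \<and> adj b d \<and> adj d c \<or> adj a c \<and> adj c b \<and> adj b d
      \<or> adj a c \<and> adj c d \<and> adj d b \<or> adj a d \<and> adj d b \<and> adj b c \<or> adj a d \<and> adj d c \<and> adj c b
      \<or> adj b a \<and> adj a c \<and> adj c d \<or> adj b a \<and> adj a d \<and> adj d c
      \<or> adj c a \<and> adj a b \<and> adj b d \<or> adj c a \<and> adj a d \<and> adj d b
      \<or> adj d a \<and> adj a b \<and> adj b c \<or> adj d a \<and> adj a c \<and> adj c b"
      using enum[OF D_eq dist'] adj
      unfolding adj_commute[of b a] adj_commute[of c a] adj_commute[of d a]
        adj_commute[of c b] adj_commute[of d b] adj_commute[of d c]
      by (cases "adj a b"; cases "adj a c"; cases "adj a d";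
          cases "adj b c"; cases "adj b d"; cases "adj c d") simp_all
    then show thesis
      by (elim disjE; intro path[OF D_eq dist'])
        (use dist adj in \<open>force simp: insert_commute\<close>)+
  next
    case (one a)
    have "card (D - {p, a}) = 3" using D p one(1) fin by (auto simp: card_Diff_subset card_insert_if)
    then obtain b c d where "D - {p, a} = {b, c, d}" "distinct [b, c, d]"
      by (auto simp: card_Suc_eq numeral_eq_Suc)
    then have D_eq: "D = {p, a, b, c, d}" and dist: "distinct [p, a, b, c, d]"
      and adj: "adj p b" "adj p c" "adj p d"
      using p one by auto
    \<comment> \<open>Apart from their first edges, the two candidate paths partition the six pairs
      in \<open>{a, b, c, d}\<close>, and at most one of these pairs is still missing.\<close>
    have "adj p b \<and> adj b a \<and> adj a c \<and> adj c d \<or> adj p c \<and> adj c b \<and> adj b d \<and> adj d a"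
      using enum[OF D_eq dist] one(2) adj
      unfolding adj_commute[of b a] adj_commute[of c a] adj_commute[of d a] adj_commute[of c b]
      by (cases "adj a b"; cases "adj a c"; cases "adj a d";
          cases "adj b c"; cases "adj b d"; cases "adj c d") simp_all
    then show thesis
      by (elim disjE; intro path[OF D_eq dist]) (assumption | use dist in force)+
  next
    case (two a b)
    have "card (D - {p, a, b}) = 2" using D p two(1,3) fin by (auto simp: card_Diff_subset card_insert_if)
    then obtain c d where "D - {p, a, b} = {c, d}" "distinct [c, d]"
      by (auto simp: card_Suc_eq numeral_eq_Suc)
    then have D_eq: "D = {p, a, b, c, d}" and dist: "distinct [p, a, b, c, d]"
      using p two by auto
    \<comment> \<open>Both missing edges meet \<open>p\<close>, so every other pair is
      adjacent.\<close>
    have "adj p c \<and> adj c a \<and> adj a b \<and> adj b d"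
      using enum[OF D_eq dist] two(2,4) le1[of "adj p d"] le1[of "adj a d"] le1[of "adj b c"]
        le1[of "adj c d"]
      unfolding adj_commute[of c a]
      by (cases "adj p c"; cases "adj a c"; cases "adj a b"; cases "adj b d") simp_all
    then show thesis
      by (rule path[OF D_eq dist]) (use dist in auto)
  qed
qed

text \<open>With eight edges a Hamiltonian path of \<open>D\<close> starts at any prescribed vertex
  \<open>p\<close>; an outside neighbour of \<open>p\<close> would extend it to six
  vertices.\<close>

lemma P6_free_card5_closed:
  assumes S: "P6_free S" and D: "D \<subseteq> S" "card D = 5" "16 \<le> deg_sum D"
  shows "closed_in S D"
  unfolding closed_in_def
proof (intro conjI ballI notI D(1))
  fix p v assume p: "p \<in> D" and v: "v \<in> S - D" and "adj p v"
  obtain q r s t where "D = {p, q, r, s, t}" "distinct [p, q, r, s, t]"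
    "adj p q" "adj q r" "adj r s" "adj s t"
    using hamiltonian_path_card5[OF D(2,3) p] by blast
  then show False
    using P6_freeD[OF S, of v p q r s t] v D(1) adj_sym[OF \<open>adj p v\<close>] by auto
qed

section \<open>Closed sets of four or five vertices\<close>

lemma neighbours_eq:
  assumes "card {u \<in> S. adj v u} \<ge> 3" "\<And>u. u \<in> S \<Longrightarrow> adj v u \<Longrightarrow> u \<in> {a, b, c}"
  shows "adj v a" "adj v b" "adj v c"
proof -
  have "{u \<in> S. adj v u} \<subseteq> {a, b, c}" using assms by auto
  moreover have "card {a, b, c} \<le> 3" by (simp add: card_insert_if)
  ultimately have "{u \<in> S. adj v u} = {a, b, c}"
    using assms(1) by (meson card_seteq finite.intros le_trans)
  then show "adj v a" "adj v b" "adj v c" by auto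
qed

lemma obtain_third_neighbour:
  assumes "3 \<le> deg S v"
  obtains u where "u \<in> S" "adj v u" "u \<noteq> a" "u \<noteq> b"
proof -
  have "\<not> {u \<in> S. adj v u} \<subseteq> {a, b}"
  proof
    assume "{u \<in> S. adj v u} \<subseteq> {a, b}"
    then have "deg S v \<le> card {a, b}" unfolding deg_def by (rule card_mono[rotated]) simp
    then show False using assms by (simp add: card_insert_if split: if_splits)
  qed
  then show ?thesis using that by blast
qed

text \<open>Opening the cycle at the vertex where an outside neighbour attaches yields a path on six
  vertices.\<close>

lemma cycle5_closed:
  assumes S: "P6_free S" and in_S: "{a, b, c, d, e} \<subseteq> S" and dist: "distinct [a, b, c, d, e]"
    and cyc: "adj a b" "adj b c" "adj c d" "adj d e" "adj e a"
  shows "closed_in S {a, b, c, d, e}"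
  unfolding closed_in_def
proof (intro conjI ballI notI in_S)
  fix p v assume p: "p \<in> {a, b, c, d, e}" and v: "v \<in> S - {a, b, c, d, e}" and pv: "adj p v"
  have *: "\<not> adj v q" if "v \<notin> {q, r, s, t, u}" "{q, r, s, t, u} \<subseteq> S" "distinct [q, r, s, t, u]"
    "adj q r" "adj r s" "adj s t" "adj t u" for q r s t u
  proof
    assume "adj v q"
    moreover have "{v, q, r, s, t, u} \<subseteq> S" using that(2) v by simp
    moreover have "distinct [v, q, r, s, t, u]" using that(1,3) by simp
    ultimately show False using P6_freeD[OF S, of v q r s t u] that(4-7) by blast
  qed
  have outside: "v \<noteq> a" "v \<noteq> b" "v \<noteq> c" "v \<noteq> d" "v \<noteq> e" using v by auto
  have "\<not> adj v a" by (intro *[of a b c d e]) (use cyc dist in_S outside in auto)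
  moreover have "\<not> adj v b" by (intro *[of b c d e a]) (use cyc dist in_S outside in auto)
  moreover have "\<not> adj v c" by (intro *[of c d e a b]) (use cyc dist in_S outside in auto)
  moreover have "\<not> adj v d" by (intro *[of d e a b c]) (use cyc dist in_S outside in auto)
  moreover have "\<not> adj v e" by (intro *[of e a b c d]) (use cyc dist in_S outside in auto)
  ultimately show False using p adj_sym[OF pv] by blast
qed

text \<open>An end of a longest path has all its neighbours on the path, and having three of them
  closes a cycle through exactly the vertices of the path. The split is by whether a path on five
  vertices exists; minimum degree three always gives one on four.\<close>

lemma min_degree3_obtain_component:
  assumes S: "P6_free S" "finite S" "S \<noteq> {}" and deg3: "\<And>v. v \<in> S \<Longrightarrow> 3 \<le> deg S v"
  obtains D where "closed_in S D" "card D = 4 \<or> card D = 5"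
proof (cases "\<exists>a b c d e. {a, b, c, d, e} \<subseteq> S \<and> distinct [a, b, c, d, e] \<and>
    adj a b \<and> adj b c \<and> adj c d \<and> adj d e")
  case True
  then obtain a b c d e where in_S: "{a, b, c, d, e} \<subseteq> S" and dist: "distinct [a, b, c, d, e]"
    and path: "adj a b" "adj b c" "adj c d" "adj d e" by blast
  show ?thesis
  proof (cases "adj e a")
    case True
    then have "closed_in S {a, b, c, d, e}"
      using cycle5_closed[OF S(1) in_S dist path] by blast
    then show ?thesis using dist by (intro that[of "{a, b, c, d, e}"]) auto
  next
    case False
    have nb_a: "u \<in> {b, c, d}" if "u \<in> S" "adj a u" for u
    proof (rule ccontr)
      assume "u \<notin> {b, c, d}"
      moreover have "u \<noteq> a" "u \<noteq> e" using that False adj_sym adj_irrefl by blast+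
      ultimately have "distinct [u, a, b, c, d, e]" "{u, a, b, c, d, e} \<subseteq> S"
        using that dist in_S by auto
      then show False using P6_freeD[OF S(1), of u a b c d e] path adj_sym[OF that(2)] by blast
    qed
    have nb_e: "u \<in> {b, c, d}" if "u \<in> S" "adj e u" for u
    proof (rule ccontr)
      assume "u \<notin> {b, c, d}"
      moreover have "u \<noteq> e" "u \<noteq> a" using that False adj_irrefl by blast+
      ultimately have "distinct [a, b, c, d, e, u]" "{a, b, c, d, e, u} \<subseteq> S"
        using that dist in_S by auto
      then show False using P6_freeD[OF S(1), of a b c d e u] path that(2) by blast
    qed
    have "3 \<le> card {u \<in> S. adj a u}" "3 \<le> card {u \<in> S. adj e u}"
      using deg3[of a] deg3[of e] in_S by (auto simp: deg_def)
    then have "adj a c" "adj a d" "adj e b"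
      using neighbours_eq[of S a b c d] neighbours_eq[of S e b c d] nb_a nb_e by blast+
    \<comment> \<open>Once \<open>a\<close> and \<open>e\<close> are both joined to
      \<open>b\<close>, \<open>c\<close> and \<open>d\<close>, the path edge \<open>bc\<close> is
      the only other edge needed for a five-cycle.\<close>
    then have "closed_in S {a, c, b, e, d}"
      using in_S dist path by (intro cycle5_closed[OF S(1)]) (auto intro: adj_sym)
    then show ?thesis using dist by (intro that[of "{a, c, b, e, d}"]) auto
  qed
next
  case False
  then have no_P5: "\<not> adj d e" if "{a, b, c, d, e} \<subseteq> S" "distinct [a, b, c, d, e]"
    "adj a b" "adj b c" "adj c d" for a b c d e
    using that by blast
  obtain b where b: "b \<in> S" using S by blast
  obtain c where c: "c \<in> S" "adj b c" using obtain_third_neighbour[OF deg3[OF b]] by blast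
  obtain d where d: "d \<in> S" "adj c d" "d \<noteq> b" using obtain_third_neighbour[OF deg3[OF c(1)]] by blast
  obtain a where a: "a \<in> S" "adj b a" "a \<noteq> c" "a \<noteq> d"
    using obtain_third_neighbour[OF deg3[OF b]] by blast
  have dist: "distinct [a, b, c, d]" using a c d adj_irrefl by auto
  have "u \<in> {b, c, d}" if "u \<in> S" "adj a u" for u
  proof (rule ccontr)
    assume "u \<notin> {b, c, d}"
    then have "distinct [u, a, b, c, d]" "{u, a, b, c, d} \<subseteq> S"
      using that dist adj_irrefl a b c d by auto
    then show False using no_P5[of u a b c d] adj_sym[OF that(2)] adj_sym[OF a(2)] c(2) d(2) by blast
  qed
  moreover have "3 \<le> card {u \<in> S. adj a u}" using deg3[of a] a by (auto simp: deg_def)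
  ultimately have ad: "adj a d" using neighbours_eq[of S a b c d] by blast
  have "closed_in S {a, b, c, d}"
    unfolding closed_in_def
  proof (intro conjI ballI notI)
    show "{a, b, c, d} \<subseteq> S" using a b c d by simp
    fix p v assume p: "p \<in> {a, b, c, d}" and v: "v \<in> S - {a, b, c, d}" and pv: "adj p v"
    have *: "\<not> adj v q" if "v \<notin> {q, r, s, t}" "{q, r, s, t} \<subseteq> S" "distinct [q, r, s, t]"
      "adj q r" "adj r s" "adj s t" for q r s t
    proof
      assume "adj v q"
      moreover have "{v, q, r, s, t} \<subseteq> S" using that(2) v by simp
      moreover have "distinct [v, q, r, s, t]" using that(1,3) by simp
      ultimately show False using no_P5[of v q r s t] that(4-6) by blast
    qed
    have outside: "v \<noteq> a" "v \<noteq> b" "v \<noteq> c" "v \<noteq> d" using v by auto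
    have cyc: "adj a b" "adj b c" "adj c d" "adj d a"
      using adj_sym[OF a(2)] c(2) d(2) adj_sym[OF ad] .
    have "\<not> adj v a" by (intro *[of a b c d]) (use cyc dist a b c d outside in auto)
    moreover have "\<not> adj v b" by (intro *[of b c d a]) (use cyc dist a b c d outside in auto)
    moreover have "\<not> adj v c" by (intro *[of c d a b]) (use cyc dist a b c d outside in auto)
    moreover have "\<not> adj v d" by (intro *[of d a b c]) (use cyc dist a b c d outside in auto)
    ultimately show False using p adj_sym[OF pv] by blast
  qed
  then show ?thesis using dist by (intro that[of "{a, b, c, d}"]) auto
qed

text \<open>The Erdos-Gallai bound for \<open>P_6\<close>, at most two edges per vertex. Deleting a
  vertex of degree at most 2 lowers the degree sum by at most 4; without such a vertex a closed set
  of 4 or 5 vertices splits off, and inside it degrees are at most 4.\<close>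

lemma deg_sum_le_P6_free:
  assumes "finite S" "P6_free S"
  shows "deg_sum S \<le> 4 * card S"
  using assms
proof (induction "card S" arbitrary: S rule: less_induct)
  case less
  consider "card S \<le> 5" | v where "v \<in> S" "deg S v \<le> 2"
    | "S \<noteq> {}" "\<And>v. v \<in> S \<Longrightarrow> 3 \<le> deg S v"
  proof -
    have "deg S v \<le> 2 \<or> 3 \<le> deg S v" for v by linarith
    moreover have "S = {} \<Longrightarrow> card S \<le> 5" by simp
    ultimately show ?thesis using that by blast
  qed
  then show ?case
  proof cases
    case 1
    then have "card S * (card S - 1) \<le> card S * 4" by (intro mult_le_mono2) simp
    then show ?thesis using deg_sum_le[OF less.prems(1)] by linarith
  next
    case 2
    have "card (S - {v}) < card S" using 2 less.prems by (intro card_Diff1_less) auto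
    then have "deg_sum (S - {v}) \<le> 4 * card (S - {v})"
      using less P6_free_mono[of S "S - {v}"] by auto
    moreover have "card S = Suc (card (S - {v}))" by (rule card.remove[OF less.prems(1) 2(1)])
    ultimately show ?thesis using deg_sum_remove[OF less.prems(1) 2(1)] 2(2) by linarith
  next
    case 3
    obtain D where D: "closed_in S D" "card D = 4 \<or> card D = 5"
      using min_degree3_obtain_component[OF less.prems(2,1) 3] by blast
    have sub: "D \<subseteq> S" using D by (simp add: closed_in_def)
    then have fin: "finite D" using less.prems finite_subset by blast
    have card: "card S = card D + card (S - D)"
      using sub less.prems fin by (simp add: card_Diff_subset card_mono)
    then have "card (S - D) < card S" using D(2) by auto
    then have "deg_sum (S - D) \<le> 4 * card (S - D)"
      using less P6_free_mono[of S "S - D"] by auto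
    moreover have "deg_sum D \<le> 4 * card D" using deg_sum_le[OF fin] D(2) by auto
    ultimately show ?thesis using deg_sum_closed[OF less.prems(1) D(1)] card by simp
  qed
qed

section \<open>The sharper bound without dense five-vertex sets\<close>

lemma deg_sum_even:
  assumes "finite S"
  shows "even (deg_sum S)"
  using assms
proof (induction rule: finite_induct)
  case (insert v S)
  then show ?case using deg_sum_remove[of "insert v S" v] by simp
qed (simp add: deg_sum_def)

text \<open>The same induction with a saving of 4, raised to 6 from six vertices on. The value 6 is
  sharp: two adjacent vertices joined to every vertex of an independent set attain it.\<close>

lemma deg_sum_le_no_dense5:
  assumes "finite S" "P6_free S" "S \<noteq> {}" and no_dense: "\<And>D. D \<subseteq> S \<Longrightarrow> \<not> dense5 D"
  shows "deg_sum S + (if card S \<ge> 6 then 6 else 4) \<le> 4 * card S"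
  using assms
proof (induction "card S" arbitrary: S rule: less_induct)
  case less
  \<comment> \<open>For n from 1 to 4, \<open>n (n - 1) + 4 \<le> 4 n\<close>. For n = 5 the degree
    sum is below 18 and even, hence at most 16.\<close>
  have base: "deg_sum D + 4 \<le> 4 * card D" if "D \<subseteq> S" "D \<noteq> {}" and le5: "card D \<le> 5" for D
  proof (cases "card D = 5")
    case True
    then have "\<not> 18 \<le> deg_sum D" using less.prems(4)[OF that(1)] by (simp add: dense5_def)
    moreover have "even (deg_sum D)" using deg_sum_even that(1) less.prems(1) finite_subset by blast
    ultimately have "deg_sum D \<le> 16" by (auto elim!: evenE)
    then show ?thesis using True by simp
  next
    case False
    have fin: "finite D" using that(1) less.prems(1) finite_subset by blast
    then have "card D \<noteq> 0" using that by simp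
    then consider "card D = 1" | "card D = 2" | "card D = 3" | "card D = 4" using le5 False by linarith
    then show ?thesis using deg_sum_le[OF fin] by cases simp_all
  qed
  show ?case
  proof (cases "card S \<le> 5")
    case True
    then show ?thesis using base[of S] less.prems by simp
  next
    case big: False
    consider v where "v \<in> S" "deg S v \<le> 2" | "\<And>v. v \<in> S \<Longrightarrow> 3 \<le> deg S v"
    proof -
      have "deg S v \<le> 2 \<or> 3 \<le> deg S v" for v by linarith
      then show ?thesis using that by blast
    qed
    then show ?thesis
    proof cases
      case 1
      let ?S = "S - {v}"
      have card: "card S = Suc (card ?S)" by (rule card.remove[OF less.prems(1) 1(1)])
      then have IH: "deg_sum ?S + (if card ?S \<ge> 6 then 6 else 4) \<le> 4 * card ?S"
      proof (intro less.hyps)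
        have "card ?S \<noteq> 0" using card big by linarith
        then show "?S \<noteq> {}" by (metis card.empty)
      qed (use card less.prems P6_free_mono[of S ?S] in auto)
      have rem: "deg_sum S = deg_sum ?S + 2 * deg S v" using deg_sum_remove less.prems 1 by blast
      show ?thesis
      proof (cases "card ?S \<ge> 6")
        case True
        then show ?thesis using IH rem card 1(2) by simp
      next
        case False
        then have five: "card ?S = 5" using card big by simp
        show ?thesis
        \<comment> \<open>Going from five to six vertices the saving must grow from 4 to 6. By
          parity only eight edges together with a vertex \<open>v\<close> of degree 2 could prevent
          this, but then the five vertices are closed and \<open>v\<close> has degree 0.\<close>
        proof (cases "deg_sum ?S = 16 \<and> deg S v = 2")
          case True
          then have closed: "closed_in S ?S"
            using P6_free_card5_closed[OF less.prems(2), of ?S] five by simp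
          have "\<not> adj v u" if "u \<in> S" for u
          proof (cases "u = v")
            case False
            then have "\<not> adj u v" using closed that 1(1) unfolding closed_in_def by simp
            then show ?thesis using adj_sym[of v u] by blast
          qed (simp add: adj_irrefl)
          then have "{u \<in> S. adj v u} = {}" by blast
          then have "deg S v = 0" unfolding deg_def by (simp only: card.empty)
          then show ?thesis using True by simp
        next
          case not_tight: False
          have "even (deg_sum ?S)" using deg_sum_even less.prems(1) by simp
          then obtain k where k: "deg_sum ?S = 2 * k" by (elim evenE)
          have "deg_sum ?S \<le> 16" using IH five by simp
          then have "deg_sum ?S \<le> 14 \<or> deg S v \<le> 1"
            using not_tight 1(2) k by (cases "k \<le> 7") auto
          then have "deg_sum ?S + 2 * deg S v \<le> 18" using \<open>deg_sum ?S \<le> 16\<close> 1(2) by linarith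
          then show ?thesis using rem five card by simp
        qed
      qed
    next
      case 2
      obtain D where D: "closed_in S D" "card D = 4 \<or> card D = 5"
        using min_degree3_obtain_component[OF less.prems(2,1,3) 2] by blast
      have sub: "D \<subseteq> S" using D by (simp add: closed_in_def)
      then have fin: "finite D" using less.prems finite_subset by blast
      have card: "card S = card D + card (S - D)"
        using sub less.prems fin by (simp add: card_Diff_subset card_mono)
      then have smaller: "card (S - D) < card S" and "card (S - D) \<noteq> 0" using D(2) big by auto
      then have "S - D \<noteq> {}" by (metis card.empty)
      then have "deg_sum (S - D) + (if card (S - D) \<ge> 6 then 6 else 4) \<le> 4 * card (S - D)"
        using smaller less.prems P6_free_mono[of S "S - D"] by (intro less.hyps) auto
      \<comment> \<open>Each part saves at least 4, and 4 + 4 exceeds the required 6.\<close>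
      moreover have "deg_sum D + 4 \<le> 4 * card D" using D(2) by (intro base sub) auto
      moreover have "(4 :: nat) \<le> (if card (S - D) \<ge> 6 then 6 else 4)"
        "(if card S \<ge> 6 then 6 else 4) \<le> (6 :: nat)" by simp_all
      ultimately show ?thesis using deg_sum_closed[OF less.prems(1) D(1)] card by linarith
    qed
  qed
qed

section \<open>The weighted excess of a vertex set\<close>

text \<open>Degrees are taken once, in all of \<open>S\<close>, so this is not the iterated 2-core.
  It collects the vertices whose coefficient in \<open>excess\<close> is nonnegative.\<close>

definition core :: "'a set \<Rightarrow> 'a set" where
  "core S = {v \<in> S. 2 \<le> deg S v}"

definition excess :: "'a set \<Rightarrow> ('a \<Rightarrow> real) \<Rightarrow> real" where
  "excess S x = (\<Sum>v\<in>S. (real (deg S v) - 2) * x v) - real (deg_sum S) / 2"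

lemma real_deg_conv_sum: "finite S \<Longrightarrow> real (deg S v) = (\<Sum>u\<in>S. of_bool (adj v u))"
  by (simp add: deg_conv_sum)

lemma sum_deg_swap:
  assumes "finite A" "finite B"
  shows "(\<Sum>a\<in>A. \<Sum>b\<in>B. of_bool (adj a b) * f b) = (\<Sum>b\<in>B. real (deg A b) * f b)"
  using assms
  by (subst sum.swap) (simp add: real_deg_conv_sum sum_distrib_right adj_commute del: sum_of_bool_eq)

text \<open>On the core the coefficients are nonnegative, so weights are raised to 1; off the core
  they are at most -1. Edges between core and rest then cancel against the subtracted edge count,
  and edges inside the rest only lower the value.\<close>

lemma excess_le:
  assumes S: "finite S" and x: "\<And>v. v \<in> S \<Longrightarrow> 0 \<le> x v" "\<And>v. v \<in> S \<Longrightarrow> x v \<le> 1"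
  shows "excess S x \<le> real (deg_sum (core S)) / 2 - 2 * real (card (core S)) - sum x (S - core S)"
proof -
  let ?C = "core S"
  have C: "?C \<subseteq> S" "finite ?C" using S by (auto simp: core_def)
  have split: "sum f S = sum f ?C + sum f (S - ?C)" for f :: "'a \<Rightarrow> real"
    using sum.subset_diff[OF C(1) S, of f] by simp
  have "(\<Sum>v\<in>?C. (real (deg S v) - 2) * x v) \<le> (\<Sum>v\<in>?C. real (deg S v) - 2)"
    using x C(1) by (intro sum_mono mult_left_le) (auto simp: core_def)
  moreover have "(\<Sum>v\<in>S - ?C. (real (deg S v) - 2) * x v) \<le> (\<Sum>v\<in>S - ?C. - x v)"
  proof (intro sum_mono)
    fix v assume v: "v \<in> S - ?C"
    then have "real (deg S v) - 2 \<le> -1" by (auto simp: core_def)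
    then show "(real (deg S v) - 2) * x v \<le> - x v"
      using mult_right_mono[of "real (deg S v) - 2" "-1" "x v"] x v by simp
  qed
  moreover have "real (deg_sum S) = real (deg_sum ?C) + real (deg_sum (S - ?C))
      + 2 * (\<Sum>v\<in>?C. real (deg (S - ?C) v))"
    using deg_sum_Un[of ?C "S - ?C"] C S by (simp add: Un_absorb1)
  moreover have "(\<Sum>v\<in>?C. real (deg S v) - 2)
      = real (deg_sum ?C) + (\<Sum>v\<in>?C. real (deg (S - ?C) v)) - 2 * real (card ?C)"
  proof -
    have "deg S v = deg ?C v + deg (S - ?C) v" for v
      using deg_Un[of ?C "S - ?C" v] C S by (simp add: Un_absorb1)
    then show ?thesis by (simp add: deg_sum_def sum.distrib sum_subtractf)
  qed
  ultimately show ?thesis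
    unfolding excess_def split[of "\<lambda>v. (real (deg S v) - 2) * x v"] sum_negf by linarith
qed

lemma excess_closed:
  assumes "finite S" "closed_in S D"
  shows "excess S x = excess D x + excess (S - D) x"
proof -
  have D: "D \<subseteq> S" "finite D" using assms finite_subset by (auto simp: closed_in_def)
  have "{u \<in> S. adj v u} = {u \<in> D. adj v u}" if "v \<in> D" for v
    using that assms(2) by (auto simp: closed_in_def)
  then have degD: "deg S v = deg D v" if "v \<in> D" for v using that by (simp add: deg_def)
  have "{u \<in> S. adj v u} = {u \<in> S - D. adj v u}" if "v \<in> S - D" for v
    using that assms(2) adj_sym[of v] by (auto simp: closed_in_def)
  then have "deg S v = deg (S - D) v" if "v \<in> S - D" for v using that by (simp add: deg_def)
  then show ?thesis
    using sum.subset_diff[OF D(1) assms(1), of "\<lambda>v. (real (deg S v) - 2) * x v"]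
      deg_sum_closed[OF assms] degD
    by (simp add: excess_def add_divide_distrib)
qed

lemma excess_nonpos:
  assumes "finite S" "P6_free S" "\<And>v. v \<in> S \<Longrightarrow> 0 \<le> x v" "\<And>v. v \<in> S \<Longrightarrow> x v \<le> 1"
  shows "excess S x \<le> 0"
proof -
  have C: "core S \<subseteq> S" "finite (core S)" using assms(1) by (auto simp: core_def)
  have "real (deg_sum (core S)) \<le> 4 * real (card (core S))"
    using deg_sum_le_P6_free[OF C(2) P6_free_mono[OF assms(2) C(1)]] by linarith
  moreover have "0 \<le> sum x (S - core S)" using assms(3) by (intro sum_nonneg) auto
  ultimately show ?thesis using excess_le[where x = x, OF assms(1,3,4)] by linarith
qed

text \<open>The names are chosen so that \<open>a b\<close> is the only pair that may be
  nonadjacent.\<close>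

lemma dense5_obtain:
  assumes "dense5 D"
  obtains a b c d e where "D = {a, b, c, d, e}" "distinct [a, b, c, d, e]"
    "adj a c" "adj a d" "adj a e" "adj b c" "adj b d" "adj b e" "adj c d" "adj c e" "adj d e"
proof -
  have D: "card D = 5" "18 \<le> deg_sum D" using assms by (auto simp: dense5_def)
  then have fin: "finite D" by (simp add: card_ge_0_finite)
  obtain a b where ab: "a \<in> D" "b \<in> D - {a}"
    and all: "\<not> adj a b \<or> (\<forall>u\<in>D. \<forall>v\<in>D. u \<noteq> v \<longrightarrow> adj u v)"
  proof (cases "\<exists>a\<in>D. \<exists>b\<in>D - {a}. \<not> adj a b")
    case False
    obtain a where a: "a \<in> D" using D(1) by fastforce
    have "card (D - {a}) = 4" using a D(1) by simp
    then have "D - {a} \<noteq> {}" by (metis card.empty zero_neq_numeral)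
    then obtain b where "b \<in> D - {a}" by blast
    then show ?thesis using False a that by blast
  qed (use that in blast)
  have "card (D - {a, b}) = 3" using D(1) ab fin by (auto simp: card_Diff_subset card_insert_if)
  then obtain c d e where "D - {a, b} = {c, d, e}" "distinct [c, d, e]"
    by (auto simp: card_Suc_eq numeral_eq_Suc)
  then have D_eq: "D = {a, b, c, d, e}" and dist: "distinct [a, b, c, d, e]" using ab by auto
  have half: "18 \<le> 2 * x \<Longrightarrow> 9 \<le> x" for x :: nat by simp
  have "9 \<le> (of_bool (adj a b) + of_bool (adj a c) + of_bool (adj a d)
    + of_bool (adj a e) + of_bool (adj b c) + of_bool (adj b d) + of_bool (adj b e)
    + of_bool (adj c d) + of_bool (adj c e) + of_bool (adj d e) :: nat)"
    using D(2) unfolding D_eq deg_sum_5[OF dist] by (rule half)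
  then have "adj a c \<and> adj a d \<and> adj a e \<and> adj b c \<and> adj b d \<and> adj b e \<and> adj c d \<and> adj c e \<and> adj d e"
    if "\<not> adj a b" using that
    by (cases "adj a c"; cases "adj a d"; cases "adj a e"; cases "adj b c"; cases "adj b d";
        cases "adj b e"; cases "adj c d"; cases "adj c e"; cases "adj d e") simp_all
  moreover have "adj a c \<and> adj a d \<and> adj a e \<and> adj b c \<and> adj b d \<and> adj b e \<and> adj c d \<and> adj c e \<and> adj d e"
    if "adj a b" using all that dist unfolding D_eq by simp
  ultimately show ?thesis using that[OF D_eq dist] by blast
qed

end

subsection \<open>The extremal vertex and its neighbourhood\<close>

text \<open>A graph reaching the bound, with an eigenvector scaled to have maximum 1 at
  \<open>u0\<close>. In \<open>fan_free\<close> the hub is \<open>c\<close> and the six-vertex path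
  is \<open>p1\<close> to \<open>p6\<close>.\<close>

locale extremal_graph = simple_adj adj
  for adj :: "'a \<Rightarrow> 'a \<Rightarrow> bool" +
  fixes V :: "'a set" and x :: "'a \<Rightarrow> real" and \<rho> :: real and u0 :: 'a and m :: nat
  assumes finite_V: "finite V"
    and adj_V: "adj u v \<Longrightarrow> u \<in> V"
    and no_isolated: "v \<in> V \<Longrightarrow> \<exists>w. adj v w"
    and fan_free: "\<lbrakk>distinct [p1, p2, p3, p4, p5, p6];
      adj c p1; adj c p2; adj c p3; adj c p4; adj c p5; adj c p6;
      adj p1 p2; adj p2 p3; adj p3 p4; adj p4 p5; adj p5 p6\<rbrakk> \<Longrightarrow> False"
    and size: "deg_sum V = 2 * m" "33 \<le> m"
    and u0_V: "u0 \<in> V" and x_u0: "x u0 = 1"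
    and x_nonneg: "v \<in> V \<Longrightarrow> 0 \<le> x v" and x_le_1: "v \<in> V \<Longrightarrow> x v \<le> 1"
    and eigen: "u \<in> V \<Longrightarrow> (\<Sum>v\<in>V. of_bool (adj u v) * x v) = \<rho> * x u"
    and rho_ge: "1 + sqrt (real m - 2) \<le> \<rho>"
begin

definition N :: "'a set" where "N = {v \<in> V. adj u0 v}"
definition W :: "'a set" where "W = V - {u0} - N"
text \<open>The loss incurred when each edge between \<open>N\<close> and \<open>W\<close> is
  weighted by \<open>x w\<close> instead of 1.\<close>

definition cost :: real where "cost = (\<Sum>w\<in>W. real (deg N w) * (1 - x w))"

section \<open>Eigenvalue equations around the extremal vertex\<close>

lemma adj_V': "adj u v \<Longrightarrow> v \<in> V"
  using adj_V[OF adj_sym] .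

lemma N_V: "N \<subseteq> V" and W_V: "W \<subseteq> V" and fin_N: "finite N" and fin_W: "finite W"
  using finite_V by (auto simp: N_def W_def)

lemma u0_notin: "u0 \<notin> N" "u0 \<notin> W" and N_W: "N \<inter> W = {}"
  by (auto simp: N_def W_def adj_irrefl)

lemma V_eq: "insert u0 (N \<union> W) = V"
  using u0_V by (auto simp: N_def W_def)

lemma adj_u0: "v \<in> N \<Longrightarrow> adj u0 v" "v \<in> N \<Longrightarrow> adj v u0" "w \<in> W \<Longrightarrow> \<not> adj w u0"
  by (auto simp: N_def W_def dest: adj_sym)

lemma x_N: "v \<in> N \<Longrightarrow> 0 \<le> x v" "v \<in> N \<Longrightarrow> x v \<le> 1"
  and x_W: "w \<in> W \<Longrightarrow> 0 \<le> x w" "w \<in> W \<Longrightarrow> x w \<le> 1"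
  using x_nonneg x_le_1 N_V W_V by auto

lemma sum_V: "sum f V = f u0 + sum f N + sum f W" for f :: "'a \<Rightarrow> real"
proof -
  have "sum f (insert u0 (N \<union> W)) = f u0 + sum f N + sum f W"
    using fin_N fin_W u0_notin N_W by (simp add: sum.union_disjoint)
  then show ?thesis by (simp add: V_eq)
qed

text \<open>\<open>m - 2\<close> is at least 31, which exceeds the square of 11/2. The value 13/2
  drives the numerical estimates on \<open>card N\<close>, on dense five-vertex sets and on the size
  of \<open>W\<close>.\<close>

lemma rho_ge': "13 / 2 \<le> \<rho>"
proof -
  have "11 / 2 \<le> sqrt (real m - 2)" using size(2) by (intro real_le_rsqrt) (simp add: power2_eq_square)
  then show ?thesis using rho_ge by linarith
qed

lemma rho_sq: "real m - 3 \<le> \<rho> * \<rho> - 2 * \<rho>"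
proof -
  have "0 \<le> real m - 2" using size(2) by simp
  then have "real m - 2 = sqrt (real m - 2) * sqrt (real m - 2)" by simp
  also have "\<dots> \<le> (\<rho> - 1) * (\<rho> - 1)"
    using rho_ge rho_ge' \<open>0 \<le> real m - 2\<close> by (intro mult_mono) auto
  finally show ?thesis by (simp add: algebra_simps)
qed

lemma sum_N: "sum x N = \<rho>"
proof -
  have "(\<Sum>v\<in>N. of_bool (adj u0 v) * x v) = sum x N"
    by (intro sum.cong) (auto simp: adj_u0)
  moreover have "(\<Sum>v\<in>W. of_bool (adj u0 v) * x v) = 0"
    by (intro sum.neutral) (auto simp: W_def N_def)
  ultimately show ?thesis using eigen[OF u0_V] by (simp add: sum_V adj_irrefl x_u0)
qed

lemma eigen_N:
  assumes "u \<in> N"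
  shows "\<rho> * x u = 1 + (\<Sum>v\<in>N. of_bool (adj u v) * x v) + (\<Sum>w\<in>W. of_bool (adj u w) * x w)"
  using eigen[of u] assms N_V by (auto simp: sum_V x_u0 adj_u0)

lemma eigen_W:
  assumes "w \<in> W"
  shows "\<rho> * x w = (\<Sum>v\<in>N. of_bool (adj w v) * x v) + (\<Sum>v\<in>W. of_bool (adj w v) * x v)"
  using eigen[of w] assms W_V by (auto simp: sum_V x_u0 adj_u0)

text \<open>The term 1 in the equation comes from \<open>u0\<close>. Positivity later turns subsets
  of \<open>N\<close> with total weight zero into empty sets.\<close>

lemma x_pos: "u \<in> N \<Longrightarrow> 0 < x u"
proof -
  assume u: "u \<in> N"
  have "0 \<le> (\<Sum>v\<in>N. of_bool (adj u v) * x v)" "0 \<le> (\<Sum>w\<in>W. of_bool (adj u w) * x w)"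
    using x_N x_W by (auto intro!: sum_nonneg)
  then have "1 \<le> \<rho> * x u" using eigen_N[OF u] by linarith
  then show "0 < x u" using x_N(1)[OF u] by (cases "x u = 0") auto
qed

lemma card_N: "7 \<le> card N"
proof -
  have "sum x N \<le> (\<Sum>v\<in>N. 1)" using x_N by (intro sum_mono) auto
  then show ?thesis using sum_N rho_ge' by simp
qed

lemma P6_free_N: "P6_free N"
  unfolding P6_free_def
proof (intro allI impI notI)
  fix a b c d e f
  assume "{a, b, c, d, e, f} \<subseteq> N" "distinct [a, b, c, d, e, f]"
    "adj a b" "adj b c" "adj c d" "adj d e" "adj e f"
  then show False by (intro fan_free[of a b c d e f u0]) (auto simp: adj_u0)
qed

section \<open>Comparing two-step walks with the edge count\<close>

lemma size_decomposition:
  "2 * real m = 2 * real (card N) + real (deg_sum N) + 2 * (\<Sum>w\<in>W. real (deg N w)) + real (deg_sum W)"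
proof -
  have "deg_sum V = deg_sum {u0} + deg_sum (N \<union> W) + 2 * deg (N \<union> W) u0"
    using deg_sum_Un[of "{u0}" "N \<union> W"] fin_N fin_W u0_notin by (simp add: V_eq)
  moreover have "deg_sum {u0} = 0" by (simp add: deg_sum_def deg_def adj_irrefl)
  moreover have "{v \<in> N \<union> W. adj u0 v} = N" by (auto simp: N_def W_def)
  then have "deg (N \<union> W) u0 = card N" by (simp add: deg_def)
  moreover have "deg_sum (N \<union> W) = deg_sum N + deg_sum W + 2 * (\<Sum>w\<in>W. deg N w)"
    using deg_sum_Un[OF fin_N fin_W N_W] deg_swap[OF fin_N fin_W] by simp
  ultimately have "2 * m = 2 * card N + deg_sum N + 2 * (\<Sum>w\<in>W. deg N w) + deg_sum W"
    using size(1) by simp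
  then have "real (2 * m) = real (2 * card N + deg_sum N + 2 * (\<Sum>w\<in>W. deg N w) + deg_sum W)"
    by (rule arg_cong)
  then show ?thesis by simp
qed

text \<open>Since \<open>sum x N = \<rho>\<close>, summing the eigenvalue equations over
  \<open>N\<close> evaluates \<open>\<rho> * \<rho>\<close>; double counting turns the inner sums
  into degrees, and \<open>size_decomposition\<close> brings in \<open>m\<close>. Every term on the
  right is nonnegative.\<close>

lemma excess_N:
  "excess N x + 3 = real (deg_sum W) / 2 + cost + (\<rho> * \<rho> - 2 * \<rho> - (real m - 3))"
proof -
  have "\<rho> * \<rho> = (\<Sum>u\<in>N. \<rho> * x u)" using sum_N by (simp add: sum_distrib_left[symmetric])
  also have "\<dots> = (\<Sum>u\<in>N. 1 + (\<Sum>v\<in>N. of_bool (adj u v) * x v) + (\<Sum>w\<in>W. of_bool (adj u w) * x w))"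
    by (intro sum.cong refl eigen_N)
  also have "\<dots> = real (card N) + (\<Sum>v\<in>N. real (deg N v) * x v) + (\<Sum>w\<in>W. real (deg N w) * x w)"
    unfolding sum.distrib sum_deg_swap[OF fin_N fin_N] sum_deg_swap[OF fin_N fin_W] by simp
  finally have "\<rho> * \<rho> = \<dots>" .
  moreover have "(\<Sum>v\<in>N. (real (deg N v) - 2) * x v) = (\<Sum>v\<in>N. real (deg N v) * x v) - 2 * \<rho>"
    unfolding sum_N[symmetric] by (simp add: left_diff_distrib sum_subtractf sum_distrib_left)
  moreover have "cost = (\<Sum>w\<in>W. real (deg N w)) - (\<Sum>w\<in>W. real (deg N w) * x w)"
    by (simp add: cost_def right_diff_distrib sum_subtractf)
  ultimately show ?thesis using size_decomposition unfolding excess_def by linarith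
qed

lemma cost_nonneg: "0 \<le> cost"
  unfolding cost_def using x_W by (auto intro!: sum_nonneg)

lemma excess_N_ge: "cost + real (deg_sum W) / 2 \<le> excess N x + 3"
  using excess_N rho_sq by linarith

text \<open>All neighbours of \<open>w\<close> lie in \<open>N\<close>, whose total weight is
  \<open>\<rho>\<close>; so the part of \<open>N\<close> not adjacent to \<open>w\<close> weighs
  exactly \<open>\<rho> * (1 - x w)\<close>.\<close>

lemma missing_mass:
  assumes "w \<in> W" "deg W w = 0" "D \<subseteq> N"
  shows "(\<Sum>u\<in>D. (1 - of_bool (adj w u)) * x u) \<le> \<rho> * (1 - x w)" "\<rho> * x w \<le> real (deg N w)"
proof -
  have "{u \<in> W. adj w u} = {}" using assms(2) fin_W by (simp add: deg_def)
  then have no_nb: "\<not> adj w u" if "u \<in> W" for u using that by blast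
  have "(\<Sum>v\<in>W. of_bool (adj w v) * x v) = 0" using no_nb by (intro sum.neutral) simp
  then have eq: "\<rho> * x w = (\<Sum>v\<in>N. of_bool (adj w v) * x v)" using eigen_W[OF assms(1)] by simp
  then have "\<rho> * (1 - x w) = (\<Sum>u\<in>N. (1 - of_bool (adj w u)) * x u)"
    using sum_N by (simp add: right_diff_distrib left_diff_distrib sum_subtractf)
  moreover have "(\<Sum>u\<in>D. (1 - of_bool (adj w u)) * x u) \<le> (\<Sum>u\<in>N. (1 - of_bool (adj w u)) * x u)"
    using fin_N assms(3) x_N by (intro sum_mono2) auto
  ultimately show "(\<Sum>u\<in>D. (1 - of_bool (adj w u)) * x u) \<le> \<rho> * (1 - x w)" by simp
  have "(\<Sum>v\<in>N. of_bool (adj w v) * x v) \<le> (\<Sum>v\<in>N. of_bool (adj w v))"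
    using x_N by (intro sum_mono) auto
  then show "\<rho> * x w \<le> real (deg N w)" using eq by (simp add: real_deg_conv_sum[OF fin_N])
qed

text \<open>Only vertices of \<open>U\<close> without neighbours in \<^term>\<open>W\<close> are charged, each twice its weight;
  the others are at most \<open>deg_sum W\<close> in number, each of weight at most 1.\<close>

lemma cost_ge:
  assumes D: "D \<subseteq> N" and U: "U \<subseteq> W"
    and miss: "\<And>w. w \<in> U \<Longrightarrow> 2 \<le> (\<Sum>u\<in>D. (1 - of_bool (adj w u)) * x u)"
  shows "2 * (sum x U - real (deg_sum W)) \<le> cost"
proof -
  define U0 where "U0 = {w \<in> U. deg W w = 0}"
  have "finite U" using U fin_W finite_subset by blast
  then have fin: "finite U" "finite U0" "U0 \<subseteq> U" by (auto simp: U0_def)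
  have "2 * x w \<le> real (deg N w) * (1 - x w)" if "w \<in> U0" for w
  proof -
    have w: "w \<in> W" "deg W w = 0" "w \<in> U" using that U by (auto simp: U0_def)
    have two: "2 \<le> \<rho> * (1 - x w)" using miss[OF w(3)] missing_mass(1)[OF w(1,2) D] by linarith
    \<comment> \<open>A large missing weight makes \<open>1 - x w\<close> large, while a large
      \<open>x w\<close> makes \<open>deg N w\<close> large; the product of the two effects is free
      of \<open>\<rho>\<close>.\<close>
    have "2 * x w \<le> \<rho> * (1 - x w) * x w" using two x_W(1)[OF w(1)] by (intro mult_right_mono)
    also have "\<dots> = \<rho> * x w * (1 - x w)" by simp
    also have "\<dots> \<le> real (deg N w) * (1 - x w)"
      using missing_mass(2)[OF w(1,2) D] x_W(2)[OF w(1)] by (intro mult_right_mono) auto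
    finally show ?thesis .
  qed
  then have "2 * sum x U0 \<le> (\<Sum>w\<in>U0. real (deg N w) * (1 - x w))"
    by (simp add: sum_distrib_left sum_mono)
  also have "\<dots> \<le> cost"
    unfolding cost_def using fin(3) U fin_W x_W by (intro sum_mono2) auto
  finally have "2 * sum x U0 \<le> cost" .
  moreover have "sum x (U - U0) \<le> (\<Sum>w\<in>U - U0. real (deg W w))"
    using U x_W by (intro sum_mono) (fastforce simp: U0_def)
  moreover have "\<dots> \<le> (\<Sum>w\<in>W. real (deg W w))"
    using U fin_W by (intro sum_mono2) auto
  moreover have "sum x U = sum x U0 + sum x (U - U0)"
    using sum.subset_diff[OF fin(3,1), of x] by simp
  ultimately show ?thesis by (simp add: deg_sum_def)
qed

text \<open>The rest of \<open>N\<close> has nonpositive excess, so \<open>D\<close> alone must keep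
  the total at least -3. This makes the weights on \<open>D\<close> large, and their eigenvalue
  equations then demand more weight from \<open>W\<close> than \<open>cost_ge\<close>
  allows.\<close>

lemma dense5_False:
  assumes D: "D \<subseteq> N" and dense: "dense5 D"
  shows False
proof -
  obtain a b c d e where D_eq: "D = {a, b, c, d, e}" and dist: "distinct [a, b, c, d, e]"
    and adj: "adj a c" "adj a d" "adj a e" "adj b c" "adj b d" "adj b e" "adj c d" "adj c e" "adj d e"
    using dense5_obtain[OF dense] by blast
  have adj': "adj c a" "adj d a" "adj e a" "adj c b" "adj d b" "adj e b" "adj d c" "adj e c" "adj e d"
    using adj by (simp_all add: adj_sym)
  have fin: "finite D" by (simp add: D_eq)
  have closed: "closed_in N D"
    using P6_free_card5_closed[OF P6_free_N D] dense by (simp add: dense5_def)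
  have sum_D: "sum f D = f a + f b + f c + f d + f e" for f :: "'a \<Rightarrow> real"
    using dist by (simp add: D_eq)
  have xs: "0 \<le> x a" "0 \<le> x b" "0 \<le> x c" "0 \<le> x d" "0 \<le> x e"
    "x a \<le> 1" "x b \<le> 1" "x c \<le> 1" "x d \<le> 1" "x e \<le> 1"
    using x_N D unfolding D_eq by auto
  \<comment> \<open>\<open>q\<close> is the number of edges inside \<open>W\<close>;
    \<open>y u\<close> below is the weight that \<open>u\<close> receives from
    \<open>W\<close>.\<close>
  define q where "q = real (deg_sum W) / 2"
  define U where "U = {w \<in> W. \<exists>u\<in>D. adj w u}"
  define y where "y u = (\<Sum>w\<in>W. of_bool (adj u w) * x w)" for u
  have U: "U \<subseteq> W" by (auto simp: U_def)
  have q: "0 \<le> q" by (simp add: q_def)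

  have excess_D: "cost + q \<le> excess D x + 3"
  proof -
    have "excess (N - D) x \<le> 0"
      using fin_N x_N P6_free_mono[OF P6_free_N] by (intro excess_nonpos) auto
    then show ?thesis using excess_N_ge excess_closed[OF fin_N closed, of x] by (simp add: q_def)
  qed

  \<comment> \<open>The forbidden fan has hub \<open>p\<close> and path
    \<open>w v u0 r s t\<close>.\<close>
  have fan: "\<not> adj w v"
    if "w \<in> W" "adj w p" "{p, v, r, s, t} = D" "distinct [p, v, r, s, t]"
      "adj p v" "adj p r" "adj p s" "adj p t" "adj r s" "adj s t" for w p v r s t
  proof
    assume "adj w v"
    have in_N: "p \<in> N" "v \<in> N" "r \<in> N" "s \<in> N" "t \<in> N" using D that(3) by auto
    have "w \<noteq> u0" "w \<notin> N" using that(1) by (auto simp: W_def)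
    then show False
      using in_N that(4) adj_u0(1)[of v] adj_u0(1,2) u0_notin(1) that(5-10) \<open>adj w v\<close> adj_sym[OF that(2)]
      by (intro fan_free[of w v u0 r s t p]) auto
  qed
  \<comment> \<open>Each of \<open>c\<close>, \<open>d\<close>, \<open>e\<close> is joined to all of
    \<open>D\<close>. In every case the other three vertices are ordered into a path that never uses
    the doubtful pair \<open>a b\<close>.\<close>
  have hub: "\<not> adj w v" if w: "w \<in> W" and p: "p \<in> {c, d, e}" "adj w p" and v: "v \<in> D" "v \<noteq> p" for w p v
  proof -
    consider "p = c" "v = a" | "p = c" "v = b" | "p = c" "v = d" | "p = c" "v = e"
      | "p = d" "v = a" | "p = d" "v = b" | "p = d" "v = c" | "p = d" "v = e"
      | "p = e" "v = a" | "p = e" "v = b" | "p = e" "v = c" | "p = e" "v = d"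
      using p(1) v D_eq by auto
    then show ?thesis
    proof cases
      case 1 show ?thesis using adj adj' dist w p(2) 1 by (intro fan[of w p v b d e]) (auto simp: D_eq)
    next
      case 2 show ?thesis using adj adj' dist w p(2) 2 by (intro fan[of w p v a d e]) (auto simp: D_eq)
    next
      case 3 show ?thesis using adj adj' dist w p(2) 3 by (intro fan[of w p v a e b]) (auto simp: D_eq)
    next
      case 4 show ?thesis using adj adj' dist w p(2) 4 by (intro fan[of w p v a d b]) (auto simp: D_eq)
    next
      case 5 show ?thesis using adj adj' dist w p(2) 5 by (intro fan[of w p v b c e]) (auto simp: D_eq)
    next
      case 6 show ?thesis using adj adj' dist w p(2) 6 by (intro fan[of w p v a c e]) (auto simp: D_eq)
    next
      case 7 show ?thesis using adj adj' dist w p(2) 7 by (intro fan[of w p v a e b]) (auto simp: D_eq)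
    next
      case 8 show ?thesis using adj adj' dist w p(2) 8 by (intro fan[of w p v a c b]) (auto simp: D_eq)
    next
      case 9 show ?thesis using adj adj' dist w p(2) 9 by (intro fan[of w p v b c d]) (auto simp: D_eq)
    next
      case 10 show ?thesis using adj adj' dist w p(2) 10 by (intro fan[of w p v a c d]) (auto simp: D_eq)
    next
      case 11 show ?thesis using adj adj' dist w p(2) 11 by (intro fan[of w p v a d b]) (auto simp: D_eq)
    next
      case 12 show ?thesis using adj adj' dist w p(2) 12 by (intro fan[of w p v a c b]) (auto simp: D_eq)
    qed
  qed

  have y_sum: "y a + y b + y c + y d + y e = (\<Sum>w\<in>W. real (deg D w) * x w)"
    using sum_deg_swap[OF fin fin_W, of x] unfolding sum_D y_def .
  have y_le: "y a + y b + y c + y d + y e \<le> k * sum x U"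
    if "\<And>w. w \<in> U \<Longrightarrow> real (deg D w) \<le> k" for k
  proof -
    have "deg D w = 0" if "w \<in> W - U" for w
    proof -
      have "{u \<in> D. adj w u} = {}" using that by (auto simp: U_def)
      then show ?thesis by (simp only: deg_def card.empty)
    qed
    then have "(\<Sum>w\<in>W. real (deg D w) * x w) = (\<Sum>w\<in>U. real (deg D w) * x w)"
      using fin_W U by (intro sum.mono_neutral_right) auto
    also have "\<dots> \<le> (\<Sum>w\<in>U. k * x w)"
      using that U x_W by (intro sum_mono mult_right_mono) auto
    finally show ?thesis by (simp add: y_sum sum_distrib_left)
  qed

  have eig: "\<rho> * x u = 1 + (\<Sum>v\<in>D. of_bool (adj u v) * x v) + y u" if "u \<in> D" for u
  proof -
    have "(\<Sum>v\<in>N. of_bool (adj u v) * x v) = (\<Sum>v\<in>D. of_bool (adj u v) * x v)"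
      using closed that fin_N D by (intro sum.mono_neutral_right) (auto simp: closed_in_def)
    then show ?thesis using eigen_N[of u] that D by (auto simp: y_def)
  qed
  have eqs: "\<rho> * x a = 1 + of_bool (adj a b) * x b + x c + x d + x e + y a"
    "\<rho> * x b = 1 + of_bool (adj a b) * x a + x c + x d + x e + y b"
    "\<rho> * x c = 1 + x a + x b + x d + x e + y c"
    "\<rho> * x d = 1 + x a + x b + x c + x e + y d"
    "\<rho> * x e = 1 + x a + x b + x c + x d + y e"
    using eig[of a] eig[of b] eig[of c] eig[of d] eig[of e] adj adj'
    unfolding sum_D by (auto simp: D_eq adj_irrefl adj_commute[of b a])
  define S where "S = x a + x b + x c + x d + x e"
  have "13 / 2 * S \<le> \<rho> * S"
    using rho_ge' xs by (intro mult_right_mono) (auto simp: S_def)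
  \<comment> \<open>The five eigenvalue equations enter only through their sum.\<close>
  then have rho_S: "13 / 2 * S \<le> \<rho> * x a + \<rho> * x b + \<rho> * x c + \<rho> * x d + \<rho> * x e"
    by (simp add: S_def algebra_simps)

  have deg_D: "real (deg D u) = of_bool (adj u a) + of_bool (adj u b) + of_bool (adj u c)
      + of_bool (adj u d) + of_bool (adj u e)" for u
    using dist by (simp add: real_deg_conv_sum fin sum_D del: sum_of_bool_eq)
  have degs: "real (deg D a) = 3 + of_bool (adj a b)" "real (deg D b) = 3 + of_bool (adj a b)"
    "real (deg D c) = 4" "real (deg D d) = 4" "real (deg D e) = 4"
    using adj adj' by (simp_all add: deg_D adj_irrefl adj_commute[of b a])
  have excess_eq: "excess D x = (1 + of_bool (adj a b)) * (x a + x b) + 2 * (x c + x d + x e)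
      - (9 + of_bool (adj a b))"
  proof -
    have "real (deg_sum D) = 18 + 2 * of_bool (adj a b)"
      by (simp add: deg_sum_def sum_D degs)
    then show ?thesis by (simp add: excess_def sum_D degs algebra_simps)
  qed

  have miss: "(\<Sum>u\<in>D. (1 - of_bool (adj w u)) * x u) = (1 - of_bool (adj w a)) * x a
      + (1 - of_bool (adj w b)) * x b + (1 - of_bool (adj w c)) * x c + (1 - of_bool (adj w d)) * x d
      + (1 - of_bool (adj w e)) * x e" for w
    by (rule sum_D)
  have cases_U: "(\<exists>p\<in>{c, d, e}. adj w p \<and> (\<forall>v\<in>D. v \<noteq> p \<longrightarrow> \<not> adj w v)) \<or>
      (\<not> adj w c \<and> \<not> adj w d \<and> \<not> adj w e)" if "w \<in> W" for w
    using hub[OF that] by blast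

  show False
  proof (cases "adj a b")
    case True
    have "adj b a" using True by (rule adj_sym)
    \<comment> \<open>With \<open>a b\<close> present, \<open>a\<close> too is joined to all of
      \<open>D\<close> and can serve as a hub.\<close>
    have single: "\<not> (adj w a \<and> adj w b)" if "w \<in> W" for w
      using fan[of w a b c d e] that True adj dist by (auto simp: D_eq)
    have excess: "7 + cost + q \<le> 2 * S" using excess_D excess_eq True by (simp add: S_def)
    have U_bounds: "real (deg D w) \<le> 1 \<and> 2 \<le> (\<Sum>u\<in>D. (1 - of_bool (adj w u)) * x u)" if "w \<in> U" for w
    proof -
      have w: "w \<in> W" using that U by blast
      from cases_U[OF w] show ?thesis
      proof
        assume "\<exists>p\<in>{c, d, e}. adj w p \<and> (\<forall>v\<in>D. v \<noteq> p \<longrightarrow> \<not> adj w v)"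
        then show ?thesis using dist xs excess cost_nonneg q unfolding miss deg_D
          by (auto simp: D_eq S_def)
      next
        assume "\<not> adj w c \<and> \<not> adj w d \<and> \<not> adj w e"
        then show ?thesis using single[OF w] xs excess cost_nonneg q unfolding miss deg_D
          by (cases "adj w a"; cases "adj w b") (auto simp: S_def)
      qed
    qed
    have "2 * (sum x U - real (deg_sum W)) \<le> cost" using U_bounds by (intro cost_ge[OF D U]) blast
    moreover have "y a + y b + y c + y d + y e \<le> 1 * sum x U" using U_bounds by (intro y_le) blast
    \<comment> \<open>The summed equations require \<open>W\<close> to supply at least
      \<open>5/2 S - 5\<close>, but it supplies at most \<open>cost / 2 + 2 q\<close>. With
      \<open>2 S \<ge> 7 + cost + q\<close> this gives \<open>q \<ge> 5 + cost\<close>, whereas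
      \<open>S \<le> 5\<close> gives \<open>q \<le> 3\<close>.\<close>
    ultimately show False
      using rho_S excess eqs True xs cost_nonneg q by (simp add: S_def q_def)
  next
    case False
    have excess: "6 + cost + q \<le> S + (x c + x d + x e)" using excess_D excess_eq False by (simp add: S_def)
    \<comment> \<open>Now \<open>w\<close> may see both \<open>a\<close> and \<open>b\<close>.
      Missing \<open>c\<close>, \<open>d\<close>, \<open>e\<close> still suffices: as
      \<open>x a + x b \<le> 2\<close>, the inequality \<open>excess\<close> forces
      \<open>x c + x d + x e \<ge> 2\<close>.\<close>
    have U_bounds: "real (deg D w) \<le> 2 \<and> 2 \<le> (\<Sum>u\<in>D. (1 - of_bool (adj w u)) * x u)" if "w \<in> U" for w
    proof -
      have w: "w \<in> W" using that U by blast
      from cases_U[OF w] show ?thesis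
      proof
        assume "\<exists>p\<in>{c, d, e}. adj w p \<and> (\<forall>v\<in>D. v \<noteq> p \<longrightarrow> \<not> adj w v)"
        then show ?thesis using dist xs excess cost_nonneg q unfolding miss deg_D
          by (auto simp: D_eq S_def)
      next
        assume "\<not> adj w c \<and> \<not> adj w d \<and> \<not> adj w e"
        then show ?thesis using xs excess cost_nonneg q unfolding miss deg_D
          by (cases "adj w a"; cases "adj w b") (auto simp: S_def)
      qed
    qed
    have "2 * (sum x U - real (deg_sum W)) \<le> cost" using U_bounds by (intro cost_ge[OF D U]) blast
    moreover have "y a + y b + y c + y d + y e \<le> 2 * sum x U" using U_bounds by (intro y_le) blast
    \<comment> \<open>Here the sums give
      \<open>7/2 (x a + x b) + 5/2 (x c + x d + x e) - 5 \<le> cost + 4 q\<close>. Using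
      \<open>x c + x d + x e \<le> 3\<close> this again forces \<open>q \<ge> 5\<close>, while
      \<open>excess\<close> allows only \<open>q \<le> 2\<close>.\<close>
    ultimately show False
      using rho_S excess eqs False xs cost_nonneg q by (simp add: S_def q_def)
  qed
qed

text \<open>The sharper edge bound for the core gives \<open>excess N x \<le> -3\<close>, and
  \<open>excess_N_ge\<close> gives the reverse. Hence every nonnegative quantity dropped on the way
  is zero.\<close>

lemma tight:
  shows "core N = N" "deg_sum N + 6 = 4 * card N" "cost = 0" "deg_sum W = 0" "\<rho> = 1 + sqrt (real m - 2)"
    and "\<And>v. v \<in> N \<Longrightarrow> 3 \<le> deg N v \<Longrightarrow> x v = 1"
proof -
  let ?C = "core N"
  have C: "?C \<subseteq> N" "finite ?C" using fin_N by (auto simp: core_def)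
  have no_dense: "\<not> dense5 D" if "D \<subseteq> ?C" for D using dense5_False that C(1) by blast
  have split: "\<rho> = sum x ?C + sum x (N - ?C)"
    using sum.subset_diff[OF C(1) fin_N, of x] sum_N by simp
  have le: "excess N x \<le> real (deg_sum ?C) / 2 - 2 * real (card ?C) - sum x (N - ?C)"
    using excess_le[OF fin_N, of x] x_N by blast
  have ge: "-3 \<le> excess N x" using excess_N_ge cost_nonneg by linarith
  have "?C \<noteq> {}"
  proof
    assume "?C = {}"
    then show False using le ge split rho_ge' by (simp add: deg_sum_def)
  qed
  then have bound: "deg_sum ?C + (if card ?C \<ge> 6 then 6 else 4) \<le> 4 * card ?C"
    using P6_free_mono[OF P6_free_N C(1)] no_dense C(2) by (intro deg_sum_le_no_dense5)
  \<comment> \<open>A core of at most five vertices saves only 4, so the rest weighs at most 1 and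
    \<open>\<rho>\<close> would be at most 5 + 1.\<close>
  have "card ?C \<ge> 6"
  proof (rule ccontr)
    assume "\<not> card ?C \<ge> 6"
    then have "real (deg_sum ?C) + 4 \<le> 4 * real (card ?C)" "card ?C \<le> 5" using bound by simp_all
    moreover have "sum x ?C \<le> (\<Sum>v\<in>?C. 1)" using x_N C(1) by (intro sum_mono) auto
    ultimately show False using le ge split rho_ge' by simp
  qed
  then have bound': "real (deg_sum ?C) + 6 \<le> 4 * real (card ?C)" using bound by simp
  have rest: "0 \<le> sum x (N - ?C)" using x_N by (intro sum_nonneg) auto
  then have "sum x (N - ?C) = 0" using bound' le ge by linarith
  then have "\<forall>v\<in>N - ?C. x v = 0" using fin_N x_N by (subst (asm) sum_nonneg_eq_0_iff) auto
  then have "N - ?C = {}" using x_pos by force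
  then show core: "?C = N" using C(1) by blast
  have exc: "excess N x = -3" using le ge bound' rest by linarith
  have "real (deg_sum N) + 6 = 4 * real (card N)" using le exc bound' core by simp
  then show sum: "deg_sum N + 6 = 4 * card N" by linarith
  have zero: "real (deg_sum W) / 2 + cost + (\<rho> * \<rho> - 2 * \<rho> - (real m - 3)) = 0"
    using excess_N exc by linarith
  show cost: "cost = 0" using zero cost_nonneg rho_sq by simp
  show degW: "deg_sum W = 0" using zero cost_nonneg rho_sq by simp
  have "(\<rho> - 1)\<^sup>2 = real m - 2" using zero cost degW by (simp add: power2_eq_square algebra_simps)
  then have "sqrt (real m - 2) = \<rho> - 1" using rho_ge' by (intro real_sqrt_unique) auto
  then show "\<rho> = 1 + sqrt (real m - 2)" by simp
  \<comment> \<open>Replacing all weights by 1 also gives the value -3, so the change, a sum of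
    nonnegative terms, vanishes.\<close>
  have "(\<Sum>v\<in>N. (real (deg N v) - 2) * (1 - x v)) = 0"
  proof -
    have "(\<Sum>v\<in>N. real (deg N v) - 2) = real (deg_sum N) - 2 * real (card N)"
      by (simp add: sum_subtractf deg_sum_def)
    then show ?thesis using exc sum
      by (simp add: right_diff_distrib sum_subtractf excess_def)
  qed
  moreover have "2 \<le> real (deg N v)" if "v \<in> N" for v using that core by (auto simp: core_def)
  ultimately have "\<forall>v\<in>N. (real (deg N v) - 2) * (1 - x v) = 0"
    using fin_N x_N by (subst (asm) sum_nonneg_eq_0_iff) auto
  then show "x v = 1" if "v \<in> N" "3 \<le> deg N v" for v using that by auto
qed

section \<open>Structure in the case of equality\<close>

lemma N_deg_ge: "v \<in> N \<Longrightarrow> 2 \<le> deg N v"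
  using tight(1) by (auto simp: core_def)

text \<open>As \<open>W\<close> spans no edge and \<open>w\<close> is not isolated, \<open>w\<close>
  has a neighbour in \<open>N\<close>, so zero cost forces \<open>x w = 1\<close>. Its neighbours
  then carry the full weight \<open>\<rho>\<close> of \<open>N\<close>, and all weights there are
  positive.\<close>

lemma W_complete:
  assumes "w \<in> W"
  shows "x w = 1" "u \<in> N \<Longrightarrow> adj w u"
proof -
  have "deg W w = 0" using tight(4) fin_W assms by (simp add: deg_sum_def)
  then have "{u \<in> W. adj w u} = {}" using fin_W by (simp add: deg_def)
  then have no_nb: "\<not> adj w u" if "u \<in> W" for u using that by blast
  obtain u where u: "adj w u" using no_isolated[of w] assms W_V by blast
  have "u \<in> insert u0 (N \<union> W)" using adj_V'[OF u] by (simp only: V_eq)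
  then have "u \<in> N" using no_nb[of u] u adj_u0(3)[OF assms] by auto
  then have "deg N w \<noteq> 0" using u fin_N by (auto simp: deg_def)
  moreover have "\<forall>w\<in>W. real (deg N w) * (1 - x w) = 0"
    using tight(3) fin_W x_W unfolding cost_def by (subst (asm) sum_nonneg_eq_0_iff) auto
  ultimately show w1: "x w = 1" using assms by fastforce
  have "(\<Sum>v\<in>W. of_bool (adj w v) * x v) = 0" using no_nb by (intro sum.neutral) simp
  then have "\<rho> = (\<Sum>v\<in>N. of_bool (adj w v) * x v)" using eigen_W[OF assms] w1 by simp
  then have "(\<Sum>v\<in>N. (1 - of_bool (adj w v)) * x v) = 0"
    using sum_N by (simp add: left_diff_distrib sum_subtractf)
  then have "\<forall>v\<in>N. (1 - of_bool (adj w v)) * x v = 0"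
    using fin_N x_N by (subst (asm) sum_nonneg_eq_0_iff) auto
  then show "adj w u" if "u \<in> N" for u using that x_pos[of u] by (auto split: if_splits)
qed

text \<open>\<open>u\<close> has weight 1 and sees all of \<open>W\<close>, where all weights are 1.
  Comparing its eigenvalue equation with \<open>sum x N = \<rho>\<close> shows that its
  non-neighbours in \<open>N\<close> weigh as much as \<open>W\<close>.\<close>

lemma hub:
  assumes u: "u \<in> N" "3 \<le> deg N u"
  defines "P \<equiv> {v \<in> N. adj u v}" and "Z \<equiv> N - {u} - {v \<in> N. adj u v}"
  shows "sum x Z = real (card W)" "\<rho> = 1 + sum x P + real (card W)"
    "card N = 1 + card P + card Z"
proof -
  have uP: "u \<notin> P" by (simp add: P_def adj_irrefl)
  have fin: "finite P" "finite Z" using fin_N by (auto simp: P_def Z_def)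
  have N_eq: "N = insert u (P \<union> Z)" using u by (auto simp: P_def Z_def)
  have disj: "u \<notin> P \<union> Z" "P \<inter> Z = {}" using uP by (auto simp: P_def Z_def)
  have sum_split: "sum f N = f u + sum f P + sum f Z" for f :: "'a \<Rightarrow> real"
  proof -
    have "sum f (insert u (P \<union> Z)) = f u + sum f P + sum f Z"
      using fin disj by (simp add: sum.union_disjoint)
    then show ?thesis by (simp add: N_eq[symmetric])
  qed
  have xu: "x u = 1" using tight(6) u by blast
  have "(\<Sum>v\<in>N. of_bool (adj u v) * x v) = sum x P"
  proof -
    have "(\<Sum>v\<in>P. of_bool (adj u v) * x v) = sum x P" by (intro sum.cong) (auto simp: P_def)
    moreover have "(\<Sum>v\<in>Z. of_bool (adj u v) * x v) = 0" by (intro sum.neutral) (auto simp: Z_def)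
    ultimately show ?thesis by (simp add: sum_split adj_irrefl)
  qed
  moreover have "(\<Sum>w\<in>W. of_bool (adj u w) * x w) = (\<Sum>w\<in>W. 1)"
    using W_complete u adj_sym by (intro sum.cong) auto
  ultimately show rho: "\<rho> = 1 + sum x P + real (card W)" using eigen_N[OF u(1)] xu by simp
  then show "sum x Z = real (card W)" using sum_N sum_split[of x] xu by simp
  have "card (insert u (P \<union> Z)) = 1 + card P + card Z"
    using fin disj by (simp add: card_Un_disjoint)
  then show "card N = 1 + card P + card Z" by (simp add: N_eq[symmetric])
qed

lemma obtain_hub:
  obtains u where "u \<in> N" "3 \<le> deg N u"
proof -
  have "\<exists>u\<in>N. 3 \<le> deg N u"
  proof (rule ccontr)
    assume "\<not> (\<exists>u\<in>N. 3 \<le> deg N u)"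
    then have "deg N u \<le> 2" if "u \<in> N" for u using that by force
    then have "deg_sum N \<le> card N * 2"
      unfolding deg_sum_def using sum_bounded_above[of N "deg N" 2] by simp
    then show False using tight(2) card_N by linarith
  qed
  then show thesis using that by blast
qed

lemma W_empty: "W = {}"
proof -
  obtain u where u: "u \<in> N" "3 \<le> deg N u" using obtain_hub .
  define P where "P = {v \<in> N. adj u v}"
  define Z where "Z = N - {u} - P"
  note hub = hub[OF u, folded P_def, folded Z_def]
  have fin: "finite P" "finite Z" using fin_N by (auto simp: P_def Z_def)
  have PN: "P \<subseteq> N" by (auto simp: P_def)
  have card_P: "card P = deg N u" by (simp add: P_def deg_def)
  have adj_P: "adj u v" "v \<noteq> u0" "v \<noteq> u" "v \<notin> W" if "v \<in> P" for v
    using that u0_notin N_W adj_irrefl by (auto simp: P_def)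
  have adj_W: "adj w v" "adj v w" if "w \<in> W" "v \<in> N" for w v
    using W_complete(2)[OF that] adj_sym by blast+
  have u0W: "w \<noteq> u0" if "w \<in> W" for w using that u0_notin by blast
  have "\<not> 2 \<le> card W"
  proof
    assume "2 \<le> card W"
    then obtain w1 w2 where w: "w1 \<in> W" "w2 \<in> W" "w1 \<noteq> w2"
      by (auto simp: numeral_2_eq_2 card_le_Suc_iff)
    \<comment> \<open>Three neighbours of \<open>u\<close> suffice for the fan with hub
      \<open>u\<close> and path \<open>a u0 b w1 c w2\<close>.\<close>
    obtain a b c where abc: "{a, b, c} \<subseteq> P" "distinct [a, b, c]"
      using u(2) unfolding card_P[symmetric] by (auto simp: numeral_3_eq_3 card_le_Suc_iff)
    have "a \<in> N" "b \<in> N" "c \<in> N" using abc PN by auto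
    then show False
      using abc w adj_P[of a] adj_P[of b] adj_P[of c] adj_W[of w1] adj_W[of w2] u(1) adj_u0(1,2)
        u0W[OF w(1)] u0W[OF w(2)]
      by (intro fan_free[of a u0 b w1 c w2 u]) auto
  qed
  moreover have "card W \<noteq> 1"
  proof
    assume W1: "card W = 1"
    then obtain w where W_eq: "W = {w}" by (auto simp: card_1_singleton_iff)
    have w: "w \<in> W" by (simp add: W_eq)
    have "sum x P \<le> (\<Sum>v\<in>P. 1)" using x_N PN by (intro sum_mono) auto
    \<comment> \<open>Here \<open>\<rho> = 2 + sum x P\<close>, so \<open>P\<close> weighs at least
      9/2.\<close>
    then have P5: "5 \<le> card P" using hub(2) rho_ge' W1 by simp
    \<comment> \<open>An edge \<open>a b\<close> inside \<open>P\<close> completes the path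
      \<open>a b u0 c w d\<close> under the hub \<open>u\<close>.\<close>
    have indep: "\<not> adj a b" if ab: "a \<in> P" "b \<in> P" for a b
    proof
      assume "adj a b"
      then have "a \<noteq> b" using adj_irrefl by blast
      then have "3 \<le> card (P - {a, b})" using ab P5 fin by (auto simp: card_Diff_subset card_insert_if)
      then obtain c d where cd: "{c, d} \<subseteq> P - {a, b}" "c \<noteq> d"
        by (auto simp: numeral_3_eq_3 card_le_Suc_iff)
      have "a \<in> N" "b \<in> N" "c \<in> N" "d \<in> N" using ab cd PN by auto
      then show False
        using ab cd w \<open>a \<noteq> b\<close> \<open>adj a b\<close> adj_P[of a] adj_P[of b] adj_P[of c] adj_P[of d] adj_W[of w]
          u(1) adj_u0(1,2) u0W[OF w]
        by (intro fan_free[of a b u0 c w d u]) auto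
    qed
    have N_eq: "insert u (P \<union> Z) = N" using u by (auto simp: P_def Z_def)
    have uP: "u \<notin> P" by (simp add: P_def adj_irrefl)
    have disj: "u \<notin> P \<union> Z" "P \<inter> Z = {}" using uP by (auto simp: Z_def)
    have deg_N: "deg N v = deg {u} v + deg P v + deg Z v" for v
      using deg_Un[of "{u}" "P \<union> Z" v] deg_Un[of P Z v] fin disj by (simp add: N_eq)
    have deg_u: "deg {u} v \<le> 1" for v
    proof -
      have "card {s \<in> {u}. adj v s} \<le> card {u}" by (intro card_mono) auto
      then show ?thesis by (simp only: deg_def) simp
    qed
    have sum_N': "deg_sum N = deg N u + (\<Sum>v\<in>P. deg N v) + (\<Sum>v\<in>Z. deg N v)"
    proof -
      have "(\<Sum>v\<in>insert u (P \<union> Z). deg N v) = deg N u + (\<Sum>v\<in>P. deg N v) + (\<Sum>v\<in>Z. deg N v)"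
        using fin disj by (simp add: sum.union_disjoint)
      then show ?thesis by (simp add: N_eq deg_sum_def)
    qed
    have deg_P: "deg N v \<le> 1 + deg Z v" if "v \<in> P" for v
    proof -
      have "{s \<in> P. adj v s} = {}" using indep that by blast
      then have "deg P v = 0" by (simp only: deg_def card.empty)
      then show ?thesis using deg_N[of v] deg_u[of v] by simp
    qed
    have sum_P: "(\<Sum>v\<in>P. deg N v) \<le> card P + (\<Sum>v\<in>Z. deg P v)"
    proof -
      have "(\<Sum>v\<in>P. deg N v) \<le> (\<Sum>v\<in>P. 1 + deg Z v)" by (intro sum_mono deg_P)
      also have "\<dots> = card P + (\<Sum>v\<in>P. deg Z v)" by (simp only: sum.distrib) simp
      finally show ?thesis using deg_swap[OF fin] by simp
    qed
    have degZ: "deg P v \<le> deg N v" for v using deg_N by simp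
    show False
    proof (cases "\<exists>z\<in>Z. 3 \<le> deg N z")
      \<comment> \<open>\<open>Z\<close> has total weight \<open>card W = 1\<close>, all of it on
        \<open>z\<close>, so \<open>Z = {z}\<close>. Then at most \<open>4 card P\<close> is
        available, but \<open>tight(2)\<close> demands \<open>4 card P + 2\<close>.\<close>
      case True
      then obtain z where z: "z \<in> Z" "3 \<le> deg N z" by blast
      then have "x z = 1" using tight(6) by (auto simp: Z_def)
      then have "sum x (Z - {z}) = 0" using hub(1) W1 z fin by (simp add: sum_diff1)
      then have "\<forall>v\<in>Z - {z}. x v = 0"
        using fin x_N by (subst (asm) sum_nonneg_eq_0_iff) (auto simp: Z_def)
      then have Z_eq: "Z = {z}" using z x_pos by (force simp: Z_def)
      have "\<not> adj z u" using z adj_sym[of z u] by (auto simp: Z_def P_def)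
      then have "{s \<in> {u}. adj z s} = {}" "{s \<in> {z}. adj z s} = {}" using adj_irrefl by auto
      then have "deg {u} z = 0" "deg Z z = 0" unfolding Z_eq by (simp_all only: deg_def card.empty)
      then have "deg N z = deg P z" using deg_N[of z] by simp
      moreover have "deg P z \<le> card P" unfolding deg_def using fin by (intro card_mono) auto
      ultimately have "deg_sum N \<le> 4 * card P"
        using sum_N' sum_P card_P by (simp add: Z_eq)
      then show False using tight(2) hub(3) by (simp add: Z_eq)
    next
      case False
      then have le2: "deg N z \<le> 2" if "z \<in> Z" for z using that by force
      have "(\<Sum>v\<in>Z. deg N v) \<le> card Z * 2" using sum_bounded_above[of Z "deg N" 2] le2 by simp
      moreover have "(\<Sum>v\<in>Z. deg P v) \<le> (\<Sum>v\<in>Z. deg N v)" using degZ by (intro sum_mono)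
      \<comment> \<open>\<open>tight(2)\<close> demands \<open>4 card P + 4 card Z - 2\<close>,
        which would leave \<open>card P \<le> 1\<close>.\<close>
      ultimately have "deg_sum N \<le> 2 * card P + 4 * card Z" using sum_N' sum_P card_P by linarith
      then show False using tight(2) hub(3) P5 by simp
    qed
  qed
  ultimately have "card W = 0" by linarith
  then show ?thesis using fin_W by simp
qed

text \<open>The triangle is \<open>u0\<close> with the vertices of degree at least 3 in
  \<open>N\<close>. Each of these dominates \<open>N\<close> and the others have degree 2, so the
  edge count determines how many there are.\<close>

lemma tight_structure:
  obtains T where "T \<subseteq> V" "card T = 3" "\<And>u v. u \<in> V \<Longrightarrow> v \<in> V \<Longrightarrow> adj u v \<longleftrightarrow> u \<noteq> v \<and> (u \<in> T \<or> v \<in> T)"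
proof -
  define H where "H = {u \<in> N. 3 \<le> deg N u}"
  have H: "H \<subseteq> N" "finite H" using fin_N by (auto simp: H_def)
  have dominating: "adj u v" if u: "u \<in> H" and v: "v \<in> N" "v \<noteq> u" for u v
  proof (rule ccontr)
    assume "\<not> adj u v"
    then have "v \<in> N - {u} - {v \<in> N. adj u v}" using v by simp
    moreover have "sum x (N - {u} - {v \<in> N. adj u v}) = 0" using hub(1)[of u] u by (simp add: H_def W_empty)
    then have "\<forall>v\<in>N - {u} - {v \<in> N. adj u v}. x v = 0"
      using fin_N x_N by (subst (asm) sum_nonneg_eq_0_iff) auto
    ultimately show False using x_pos[OF v(1)] by auto
  qed
  have deg_H: "deg N u = card N - 1" if "u \<in> H" for u
  proof -
    have "{v \<in> N. adj u v} = N - {u}" using dominating[OF that] adj_irrefl by auto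
    then show ?thesis using that H fin_N by (simp add: deg_def card_Diff_singleton subset_iff)
  qed
  have deg_rest: "deg N u = 2" if "u \<in> N - H" for u
    using that N_deg_ge[of u] by (auto simp: H_def)
  have "deg_sum N = (\<Sum>u\<in>H. deg N u) + (\<Sum>u\<in>N - H. deg N u)"
    unfolding deg_sum_def using sum.subset_diff[OF H(1) fin_N, of "deg N"] by simp
  also have "\<dots> = card H * (card N - 1) + 2 * (card N - card H)"
    using deg_H deg_rest H fin_N by (simp add: card_Diff_subset)
  finally have sum_eq: "deg_sum N = \<dots>" .
  obtain k where k: "card N = k + 3" "4 \<le> k" using card_N that[of "card N - 3"] by simp
  have "card H \<le> card N" using H fin_N by (simp add: card_mono)
  \<comment> \<open>With n for \<open>card N\<close> and h for \<open>card H\<close>, the count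
    \<open>h (n - 1) + 2 (n - h) = 4 n - 6\<close> reads \<open>h (n - 3) = 2 (n - 3)\<close>, and
    \<open>k = n - 3\<close> is nonzero.\<close>
  then have "card H * k = 2 * k" using sum_eq tight(2) k by (simp add: algebra_simps)
  then have card_H: "card H = 2" using k(2) by simp
  have nbs: "{u \<in> N. adj v u} = H" if v: "v \<in> N - H" for v
  proof -
    have "H \<subseteq> {u \<in> N. adj v u}" using dominating[THEN adj_sym] v H by auto
    moreover have "card {u \<in> N. adj v u} = 2" using deg_rest[OF v] by (simp add: deg_def)
    ultimately show ?thesis using card_H fin_N by (intro card_seteq[symmetric]) auto
  qed
  have V: "insert u0 N = V" using V_eq by (simp add: W_empty)
  show ?thesis
  proof (rule that[of "insert u0 H"])
    show "insert u0 H \<subseteq> V" using H N_V u0_V by blast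
    show "card (insert u0 H) = 3" using card_H H u0_notin(1) by (subst card_insert_disjoint) auto
    fix u v assume "u \<in> V" "v \<in> V"
    then have uv: "u \<in> insert u0 N" "v \<in> insert u0 N" by (simp_all only: V)
    show "adj u v \<longleftrightarrow> u \<noteq> v \<and> (u \<in> insert u0 H \<or> v \<in> insert u0 H)"
    proof (cases "u = v")
      case False
      consider "u = u0" "v \<in> N" | "v = u0" "u \<in> N" | "u \<in> H" "v \<in> N" | "v \<in> H" "u \<in> N"
        | "u \<in> N - H" "v \<in> N - H" using uv False by blast
      then show ?thesis
      proof cases
        case 1
        then show ?thesis using adj_u0(1) False by simp
      next
        case 2
        then show ?thesis using adj_u0(2) False by simp
      next
        case 3
        then show ?thesis using dominating[of u v] False by simp
      next
        case 4
        then show ?thesis using adj_sym[OF dominating[of v u]] False by simp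
      next
        case 5
        then have "\<not> adj u v" using nbs[of u] by blast
        moreover have "u \<noteq> u0" "v \<noteq> u0" using 5 u0_notin(1) by auto
        ultimately show ?thesis using 5 by simp
      qed
    qed (simp add: adj_irrefl)
  qed
qed

end

subsection \<open>Adjacency spectrum\<close>

text \<open>Bolzano-Weierstrass in finitely many coordinates: one coordinate is added at a time,
  refining by a monotone subsequence.\<close>

lemma bounded_family_convergent_subsequence:
  fixes f :: "nat \<Rightarrow> 'a \<Rightarrow> real"
  assumes "finite V" "\<And>n v. v \<in> V \<Longrightarrow> \<bar>f n v\<bar> \<le> B"
  obtains r l where "strict_mono r" "\<And>v. v \<in> V \<Longrightarrow> (\<lambda>n. f (r n) v) \<longlonglongrightarrow> l v"
proof -
  have "\<exists>r l. strict_mono (r :: nat \<Rightarrow> nat) \<and> (\<forall>v\<in>V. (\<lambda>n. f (r n) v) \<longlonglongrightarrow> l v)"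
    using assms
  proof (induction V rule: finite_induct)
    case empty
    then show ?case using strict_mono_id by blast
  next
    case (insert v V)
    obtain r l where r: "strict_mono (r :: nat \<Rightarrow> nat)" "\<forall>v\<in>V. (\<lambda>n. f (r n) v) \<longlonglongrightarrow> l v"
      using insert by blast
    obtain s where s: "strict_mono (s :: nat \<Rightarrow> nat)" "monoseq (\<lambda>n. f (r (s n)) v)"
      using seq_monosub[of "\<lambda>n. f (r n) v"] by blast
    have "Bseq (\<lambda>n. f (r (s n)) v)" using insert.prems by (intro BseqI'[of _ B]) simp
    then obtain c where c: "(\<lambda>n. f (r (s n)) v) \<longlonglongrightarrow> c"
      using Bseq_monoseq_convergent s(2) unfolding convergent_def by blast
    have "(\<lambda>n. f ((r \<circ> s) n) u) \<longlonglongrightarrow> (l(v := c)) u" if "u \<in> insert v V" for u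
    proof (cases "u = v")
      case False
      then have "(\<lambda>n. f (r n) u) \<longlonglongrightarrow> l u" using that r(2) by blast
      then show ?thesis using LIMSEQ_subseq_LIMSEQ[OF _ s(1)] False by (fastforce simp: o_def)
    qed (use c in simp)
    then show ?case using strict_mono_o[OF r(1) s(1)] by blast
  qed
  then show thesis using that by blast
qed

text \<open>A maximiser of the Rayleigh quotient may be replaced by its absolute value.\<close>

lemma nonneg_top_eigenvector:
  fixes a :: "'a \<Rightarrow> 'a \<Rightarrow> real"
  assumes V: "finite V" "V \<noteq> {}" and sym: "\<And>u v. a u v = a v u" and nonneg: "\<And>u v. 0 \<le> a u v"
  shows "\<exists>\<rho> x. (\<forall>v. 0 \<le> x v) \<and> (\<exists>v\<in>V. x v \<noteq> 0) \<and>
    (\<forall>u\<in>V. (\<Sum>v\<in>V. a u v * x v) = \<rho> * x u) \<and>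
    (\<forall>k y. (\<exists>v\<in>V. y v \<noteq> 0) \<longrightarrow> (\<forall>u\<in>V. (\<Sum>v\<in>V. a u v * y v) = k * y u) \<longrightarrow> k \<le> \<rho>)"
proof -
  \<comment> \<open>\<open>Q\<close> is the bilinear form of \<open>a\<close>, \<open>ip\<close> the
    inner product on \<open>V\<close>, and \<open>M\<close> the set of values of the quadratic form
    on the unit sphere.\<close>
  define Q where "Q y z = (\<Sum>u\<in>V. \<Sum>v\<in>V. a u v * y u * z v)" for y z :: "'a \<Rightarrow> real"
  define ip where "ip y z = (\<Sum>v\<in>V. y v * z v)" for y z :: "'a \<Rightarrow> real"
  define M where "M = {Q y y | y. ip y y = 1}"
  have Q_sym: "Q y z = Q z y" for y z
    unfolding Q_def by (subst sum.swap) (simp add: sym mult.commute mult.left_commute)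
  have Q_add: "Q (\<lambda>v. y v + t * z v) (\<lambda>v. y v + t * z v) = Q y y + 2 * t * Q y z + t\<^sup>2 * Q z z" for y z t
  proof -
    have "Q (\<lambda>v. y v + t * z v) (\<lambda>v. y v + t * z v) = Q y y + t * Q y z + t * Q z y + t\<^sup>2 * Q z z"
      unfolding Q_def sum_distrib_left sum.distrib[symmetric]
      by (intro sum.cong refl) (simp add: algebra_simps power2_eq_square)
    then show ?thesis by (simp add: Q_sym[of z y])
  qed
  have ip_add: "ip (\<lambda>v. y v + t * z v) (\<lambda>v. y v + t * z v) = ip y y + 2 * t * ip y z + t\<^sup>2 * ip z z" for y z t
    unfolding ip_def sum_distrib_left sum.distrib[symmetric]
    by (intro sum.cong refl) (simp add: algebra_simps power2_eq_square)
  have Q_scale: "Q (\<lambda>v. c * y v) (\<lambda>v. c * y v) = c\<^sup>2 * Q y y" for c y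
    unfolding Q_def sum_distrib_left by (intro sum.cong refl) (simp add: power2_eq_square)
  have ip_scale: "ip (\<lambda>v. c * y v) (\<lambda>v. c * y v) = c\<^sup>2 * ip y y" for c y
    unfolding ip_def sum_distrib_left by (intro sum.cong refl) (simp add: power2_eq_square)
  have ip_nonneg: "0 \<le> ip y y" for y unfolding ip_def by (intro sum_nonneg) simp
  have ip_pos: "0 < ip y y" if y: "\<exists>v\<in>V. y v \<noteq> 0" for y
  proof -
    obtain v where v: "v \<in> V" "y v \<noteq> 0" using y by blast
    then have "0 < y v * y v" by (auto simp: zero_less_mult_iff linorder_neq_iff)
    also have "\<dots> \<le> ip y y" unfolding ip_def using V v by (intro member_le_sum) auto
    finally show ?thesis .
  qed
  have le_1: "\<bar>y v\<bar> \<le> 1" if "ip y y = 1" "v \<in> V" for y v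
  proof -
    have "y v * y v \<le> ip y y" unfolding ip_def using V that(2) by (intro member_le_sum) auto
    then have "(y v)\<^sup>2 \<le> 1" using that(1) by (simp add: power2_eq_square)
    then show ?thesis by (simp add: abs_square_le_1)
  qed
  have bdd: "bdd_above M"
  proof (rule bdd_aboveI)
    fix q assume "q \<in> M"
    then obtain y where y: "q = Q y y" "ip y y = 1" by (auto simp: M_def)
    have "a u v * y u * y v \<le> a u v" if "u \<in> V" "v \<in> V" for u v
    proof -
      have "\<bar>y u * y v\<bar> \<le> 1" using le_1[OF y(2)] that by (simp add: abs_mult mult_le_one)
      then have "a u v * (y u * y v) \<le> a u v * 1" using nonneg by (intro mult_left_mono) auto
      then show ?thesis by (simp add: mult.assoc)
    qed
    then show "q \<le> (\<Sum>u\<in>V. \<Sum>v\<in>V. a u v)" unfolding y Q_def by (intro sum_mono)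
  qed
  have "M \<noteq> {}"
  proof -
    obtain v where "v \<in> V" using V by blast
    then have "ip (\<lambda>u. of_bool (u = v)) (\<lambda>u. of_bool (u = v)) = 1"
      using V by (simp add: ip_def of_bool_conj[symmetric] del: sum_mult_of_bool_eq)
    then show ?thesis unfolding M_def by blast
  qed
  define \<rho> where "\<rho> = Sup M"
  \<comment> \<open>A maximising sequence; the limit of a convergent subsequence attains the
    supremum.\<close>
  have "\<exists>y. ip y y = 1 \<and> \<rho> - inverse (real (Suc n)) < Q y y" for n
    using less_cSup_iff[OF \<open>M \<noteq> {}\<close> bdd, of "\<rho> - inverse (real (Suc n))"]
    by (auto simp: \<rho>_def M_def)
  then obtain f where f: "\<And>n. ip (f n) (f n) = 1" "\<And>n. \<rho> - inverse (real (Suc n)) < Q (f n) (f n)"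
    by metis
  obtain r l where r: "strict_mono r" and l: "\<And>v. v \<in> V \<Longrightarrow> (\<lambda>n. f (r n) v) \<longlonglongrightarrow> l v"
    using bounded_family_convergent_subsequence[of V f 1] V(1) le_1[OF f(1)] by blast
  have "(\<lambda>n. Q (f (r n)) (f (r n))) \<longlonglongrightarrow> Q l l" "(\<lambda>n. ip (f (r n)) (f (r n))) \<longlonglongrightarrow> ip l l"
    unfolding Q_def ip_def by (intro tendsto_sum tendsto_mult tendsto_const l; assumption)+
  then have ip_l: "ip l l = 1" and Q_lim: "(\<lambda>n. Q (f (r n)) (f (r n))) \<longlonglongrightarrow> Q l l"
    by (simp_all add: f(1) LIMSEQ_const_iff)
  have "(\<lambda>n. \<rho> - inverse (real (Suc (r n)))) \<longlonglongrightarrow> \<rho> - 0"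
    using LIMSEQ_subseq_LIMSEQ[OF LIMSEQ_inverse_real_of_nat r]
    by (intro tendsto_diff tendsto_const) (simp add: o_def)
  then have Q_l: "\<rho> \<le> Q l l" using Q_lim f(2) by (intro LIMSEQ_le) (auto intro: less_imp_le)
  have Q_le: "Q y y \<le> \<rho> * ip y y" for y
  proof (cases "ip y y = 0")
    case True
    then have "\<forall>v\<in>V. y v = 0" using ip_pos[of y] by force
    then show ?thesis using True by (simp add: Q_def)
  next
    case False
    define c where "c = 1 / sqrt (ip y y)"
    have c: "c\<^sup>2 * ip y y = 1" using False ip_nonneg by (simp add: c_def power_divide)
    then have "Q (\<lambda>v. c * y v) (\<lambda>v. c * y v) \<le> \<rho>"
      unfolding \<rho>_def using bdd by (intro cSup_upper) (auto simp: M_def ip_scale[symmetric])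
    then have "c\<^sup>2 * Q y y \<le> \<rho> * (c\<^sup>2 * ip y y)" using c by (simp add: Q_scale)
    moreover have "0 < c\<^sup>2" using c by (metis mult_zero_left zero_less_power2 zero_neq_one zero_power2)
    ultimately show ?thesis by (simp add: mult.left_commute)
  qed
  define x where "x v = \<bar>l v\<bar>" for v
  have ip_x: "ip x x = 1" using ip_l by (simp add: ip_def x_def)
  have "a u v * l u * l v \<le> a u v * x u * x v" for u v
    using mult_left_mono[OF abs_ge_self[of "l u * l v"] nonneg[of u v]]
    by (simp add: x_def abs_mult mult.assoc)
  then have "Q l l \<le> Q x x" unfolding Q_def by (intro sum_mono)
  then have Q_x: "Q x x = \<rho>" using Q_l Q_le[of x] ip_x by simp
  \<comment> \<open>First variation: perturbing the maximiser in direction \<open>z\<close> gives a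
    quadratic in \<open>t\<close> that is nonnegative everywhere and vanishes at 0, so its linear
    coefficient \<open>b\<close> is zero.\<close>
  have Q_ip: "Q x z = \<rho> * ip x z" for z
  proof -
    define b where "b = \<rho> * ip x z - Q x z"
    define e where "e = \<rho> * ip z z - Q z z"
    have quad: "0 \<le> 2 * t * b + t\<^sup>2 * e" for t
      using Q_le[of "\<lambda>v. x v + t * z v"] unfolding Q_add ip_add Q_x ip_x b_def e_def
      by (simp add: algebra_simps)
    have e: "0 \<le> e" using Q_le[of z] by (simp add: e_def)
    have "b = 0"
    proof (rule ccontr)
      assume "b \<noteq> 0"
      \<comment> \<open>The denominator \<open>e + 1\<close> instead of \<open>e\<close> also covers
        \<open>e = 0\<close>.\<close>
      define t where "t = - b / (e + 1)"
      have "2 * t * b + t\<^sup>2 * e = - (b\<^sup>2 * (e + 2)) / (e + 1)\<^sup>2"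
        using e by (simp add: t_def power2_eq_square divide_simps) (simp add: algebra_simps)
      also have "\<dots> < 0" using e \<open>b \<noteq> 0\<close> by (simp add: divide_neg_pos zero_less_mult_iff)
      finally show False using quad[of t] by simp
    qed
    then show ?thesis by (simp add: b_def)
  qed
  have Q_rows: "Q y z = (\<Sum>u\<in>V. y u * (\<Sum>v\<in>V. a u v * z v))" for y z
    unfolding Q_def sum_distrib_left by (intro sum.cong refl) (simp add: mult_ac)
  have eig: "(\<Sum>v\<in>V. a u v * x v) = \<rho> * x u" if u: "u \<in> V" for u
  proof -
    \<comment> \<open>Testing against a unit vector extracts row \<open>u\<close> of the eigenvalue
      equation.\<close>
    let ?z = "\<lambda>v. if v = u then 1 else 0 :: real"
    have "Q ?z x = (\<Sum>v\<in>V. a u v * x v)"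
      unfolding Q_rows using V u by (simp add: if_distrib[of "\<lambda>c. c * _"] sum.delta cong: if_cong)
    moreover have "ip x ?z = x u"
      unfolding ip_def using V u by (simp add: if_distrib sum.delta cong: if_cong)
    ultimately show ?thesis using Q_ip[of ?z] Q_sym[of x ?z] by simp
  qed
  have top: "k \<le> \<rho>" if y: "\<exists>v\<in>V. y v \<noteq> 0" "\<forall>u\<in>V. (\<Sum>v\<in>V. a u v * y v) = k * y u" for k y
  proof -
    have "Q y y = (\<Sum>u\<in>V. y u * (k * y u))" unfolding Q_rows using y(2) by (intro sum.cong) auto
    also have "\<dots> = k * ip y y" unfolding ip_def sum_distrib_left by (intro sum.cong) auto
    finally have "k * ip y y \<le> \<rho> * ip y y" using Q_le[of y] by simp
    then show ?thesis using ip_pos[OF y(1)] by simp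
  qed
  have "\<exists>v\<in>V. x v \<noteq> 0"
  proof (rule ccontr)
    assume "\<not> ?thesis"
    then have "ip x x = 0" by (simp add: ip_def)
    then show False using ip_x by simp
  qed
  moreover have "\<forall>v. 0 \<le> x v" by (simp add: x_def)
  ultimately show ?thesis using eig top by blast
qed

section \<open>From matrices to functions on the vertices\<close>

lemma vertex_list:
  assumes "finite (pverts G)"
  shows "distinct (vertex_list G)" "set (vertex_list G) = pverts G"
proof -
  have "\<exists>vs. distinct vs \<and> set vs = pverts G" using finite_distinct_list[OF assms] by blast
  then have "distinct (vertex_list G) \<and> set (vertex_list G) = pverts G"
    unfolding vertex_list_def by (rule someI_ex)
  then show "distinct (vertex_list G)" "set (vertex_list G) = pverts G" by auto
qed

text \<open>The enumeration is a bijection between indices and vertices, so vectors and vertex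
  functions correspond and the chosen order drops out.\<close>

lemma eigenvalue_adjacency_matrix:
  assumes "finite (pverts G)"
  shows "eigenvalue (adjacency_matrix G) k \<longleftrightarrow> (\<exists>y. (\<exists>v\<in>pverts G. y v \<noteq> 0) \<and>
    (\<forall>u\<in>pverts G. (\<Sum>v\<in>pverts G. of_bool ((u, v) \<in> parcs G) * y v) = k * y u))"
proof -
  define vs where "vs = vertex_list G"
  define n where "n = length vs"
  have vs: "distinct vs" "set vs = pverts G" using vertex_list[OF assms] by (simp_all add: vs_def)
  have A: "adjacency_matrix G = mat n n (\<lambda>(i, j). if (vs ! i, vs ! j) \<in> parcs G then 1 else 0)"
    by (simp add: adjacency_matrix_def Let_def vs_def n_def)
  have bij: "bij_betw (\<lambda>i. vs ! i) {0..<n} (pverts G)"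
    using vs bij_betw_nth[OF vs(1), of "{0..<n}"] by (auto simp: n_def atLeast0LessThan)
  have surj: "(\<lambda>i. vs ! i) ` {0..<n} = pverts G" using bij by (rule bij_betw_imp_surj_on)
  have row: "(adjacency_matrix G *\<^sub>v w) $ i = (\<Sum>v\<in>pverts G. of_bool ((vs ! i, v) \<in> parcs G) * y v)"
    if "i < n" "w \<in> carrier_vec n" "\<And>j. j < n \<Longrightarrow> w $ j = y (vs ! j)" for w y i
  proof -
    have "(adjacency_matrix G *\<^sub>v w) $ i = (\<Sum>j\<in>{0..<n}. of_bool ((vs ! i, vs ! j) \<in> parcs G) * y (vs ! j))"
      using that by (simp add: A scalar_prod_def of_bool_def)
    also have "\<dots> = (\<Sum>v\<in>pverts G. of_bool ((vs ! i, v) \<in> parcs G) * y v)"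
      using sum.reindex_bij_betw[OF bij, of "\<lambda>v. of_bool ((vs ! i, v) \<in> parcs G) * y v"] .
    finally show ?thesis .
  qed
  have dim: "dim_row (adjacency_matrix G) = n" by (simp add: A)
  show ?thesis
  proof
    assume "eigenvalue (adjacency_matrix G) k"
    then obtain w where w: "w \<in> carrier_vec n" "w \<noteq> 0\<^sub>v n" "adjacency_matrix G *\<^sub>v w = k \<cdot>\<^sub>v w"
      by (auto simp: eigenvalue_def eigenvector_def dim)
    define y where "y v = w $ (the_inv_into {0..<n} (\<lambda>i. vs ! i) v)" for v
    have y: "w $ j = y (vs ! j)" if "j < n" for j
      using the_inv_into_f_f[OF bij_betw_imp_inj_on[OF bij], of j] that by (simp add: y_def)
    have "\<exists>i<n. w $ i \<noteq> 0"
    proof (rule ccontr)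
      assume "\<not> ?thesis"
      then have "w = 0\<^sub>v n" using w(1) by (intro eq_vecI) auto
      then show False using w(2) by simp
    qed
    then obtain i where "i < n" "w $ i \<noteq> 0" by blast
    then have "\<exists>v\<in>pverts G. y v \<noteq> 0" using y bij_betwE[OF bij] by force
    moreover have "(\<Sum>v\<in>pverts G. of_bool ((u, v) \<in> parcs G) * y v) = k * y u" if "u \<in> pverts G" for u
    proof -
      obtain i where i: "i < n" "u = vs ! i" using \<open>u \<in> pverts G\<close> unfolding surj[symmetric] by auto
      have "(adjacency_matrix G *\<^sub>v w) $ i = k * w $ i" using w i by simp
      then show ?thesis using row[OF i(1) w(1) y] i y by simp
    qed
    ultimately show "\<exists>y. (\<exists>v\<in>pverts G. y v \<noteq> 0) \<and>
      (\<forall>u\<in>pverts G. (\<Sum>v\<in>pverts G. of_bool ((u, v) \<in> parcs G) * y v) = k * y u)" by blast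
  next
    assume "\<exists>y. (\<exists>v\<in>pverts G. y v \<noteq> 0) \<and>
      (\<forall>u\<in>pverts G. (\<Sum>v\<in>pverts G. of_bool ((u, v) \<in> parcs G) * y v) = k * y u)"
    then obtain y v where y: "v \<in> pverts G" "y v \<noteq> 0"
      "\<And>u. u \<in> pverts G \<Longrightarrow> (\<Sum>v\<in>pverts G. of_bool ((u, v) \<in> parcs G) * y v) = k * y u" by blast
    define w where "w = vec n (\<lambda>i. y (vs ! i))"
    have w: "w \<in> carrier_vec n" "\<And>j. j < n \<Longrightarrow> w $ j = y (vs ! j)" by (auto simp: w_def)
    obtain i where i: "i < n" "v = vs ! i" using y(1) unfolding surj[symmetric] by auto
    have "w \<noteq> 0\<^sub>v n" using w(2)[OF i(1)] i y(2) by auto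
    moreover have "adjacency_matrix G *\<^sub>v w = k \<cdot>\<^sub>v w"
    proof (rule eq_vecI)
      fix j assume "j < dim_vec (k \<cdot>\<^sub>v w)"
      then have j: "j < n" using w(1) by simp
      then have "vs ! j \<in> pverts G" using bij_betwE[OF bij] by simp
      then show "(adjacency_matrix G *\<^sub>v w) $ j = (k \<cdot>\<^sub>v w) $ j"
        using row[OF j w] y(3) j w by simp
    qed (use w(1) dim in auto)
    ultimately show "eigenvalue (adjacency_matrix G) k"
      using w(1) unfolding eigenvalue_def eigenvector_def dim by blast
  qed
qed

lemma graph_spectral_radius_eqI:
  assumes "finite (pverts G)" "eigenvalue (adjacency_matrix G) k"
    and "\<And>l. eigenvalue (adjacency_matrix G) l \<Longrightarrow> l \<le> k"
  shows "graph_spectral_radius G = k"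
proof -
  have "adjacency_matrix G \<in> carrier_mat (length (vertex_list G)) (length (vertex_list G))"
    by (simp add: adjacency_matrix_def Let_def)
  then show ?thesis
    unfolding graph_spectral_radius_def using assms card_finite_spectrum
    by (intro Max_eqI) (auto simp: spectrum_def)
qed

text \<open>Tails and heads are the projections on both sides, so the vertex map determines the arc
  map. The inclusion for \<open>parcs G\<close> is the well-formedness that
  \<open>digraph_isomorphism\<close> demands.\<close>

lemma graph_iso_iff:
  fixes G :: "'a pair_pre_digraph" and H :: "'b pair_pre_digraph"
  shows "graph_iso G H \<longleftrightarrow> parcs G \<subseteq> pverts G \<times> pverts G \<and>
    (\<exists>f. inj_on f (pverts G) \<and> pverts H = f ` pverts G \<and> parcs H = map_prod f f ` parcs G)"
proof
  assume "graph_iso G H"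
  then obtain h where h: "pre_digraph.digraph_isomorphism (with_proj G) h"
    and H: "with_proj H = app_iso h (with_proj G)"
    by (auto simp: graph_iso_def digraph_iso_def)
  have wf: "wf_digraph (with_proj G)" and inj: "inj_on (iso_verts h) (pverts G)"
    and arcs: "\<And>a. a \<in> parcs G \<Longrightarrow> iso_verts h (fst a) = iso_tail h (iso_arcs h a) \<and>
      iso_verts h (snd a) = iso_head h (iso_arcs h a)"
    using h by (auto simp: pre_digraph.digraph_isomorphism_def)
  have eqs: "pverts H = iso_verts h ` pverts G" "parcs H = iso_arcs h ` parcs G"
    "fst = iso_tail h" "snd = iso_head h"
    using H by (auto simp: app_iso_def with_proj_def)
  have "iso_arcs h a = map_prod (iso_verts h) (iso_verts h) a" if "a \<in> parcs G" for a
    using arcs[OF that] unfolding eqs(3,4)[symmetric] by (simp add: prod_eq_iff)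
  then have "parcs H = map_prod (iso_verts h) (iso_verts h) ` parcs G" using eqs(2) by auto
  moreover have "parcs G \<subseteq> pverts G \<times> pverts G"
    using wf_digraph.tail_in_verts[OF wf] wf_digraph.head_in_verts[OF wf] by auto
  ultimately show "parcs G \<subseteq> pverts G \<times> pverts G \<and>
    (\<exists>f. inj_on f (pverts G) \<and> pverts H = f ` pverts G \<and> parcs H = map_prod f f ` parcs G)"
    using inj eqs(1) by blast
next
  assume "parcs G \<subseteq> pverts G \<times> pverts G \<and>
    (\<exists>f. inj_on f (pverts G) \<and> pverts H = f ` pverts G \<and> parcs H = map_prod f f ` parcs G)"
  then obtain f where G: "parcs G \<subseteq> pverts G \<times> pverts G" and f: "inj_on f (pverts G)"
    "pverts H = f ` pverts G" "parcs H = map_prod f f ` parcs G" by blast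
  define h :: "('a, 'a \<times> 'a, 'b, 'b \<times> 'b) digraph_isomorphism" where
    "h = \<lparr> iso_verts = f, iso_arcs = map_prod f f, iso_head = snd, iso_tail = fst \<rparr>"
  have "wf_digraph (with_proj G)" using G by unfold_locales auto
  moreover have "inj_on (map_prod f f) (parcs G)"
    using inj_on_subset[OF map_prod_inj_on[OF f(1) f(1)] G] .
  ultimately have "pre_digraph.digraph_isomorphism (with_proj G) h"
    using f(1) by (simp add: pre_digraph.digraph_isomorphism_def h_def)
  moreover have "with_proj H = app_iso h (with_proj G)"
    using f(2,3) by (simp add: app_iso_def h_def with_proj_def)
  ultimately show "graph_iso G H" unfolding graph_iso_def digraph_iso_def by blast
qed

section \<open>Recognising a fan and counting arcs\<close>

lemma contains_graphI:
  assumes "wf_digraph (with_proj G)" "parcs H \<subseteq> pverts H \<times> pverts H" "inj_on f (pverts H)"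
    and "f ` pverts H \<subseteq> pverts G" "map_prod f f ` parcs H \<subseteq> parcs G"
  shows "contains_graph G H"
proof -
  let ?S = "\<lparr> pverts = f ` pverts H, parcs = map_prod f f ` parcs H \<rparr>"
  have "graph_iso H ?S" unfolding graph_iso_iff using assms(2,3) by auto
  moreover have "wf_digraph (with_proj ?S)" using assms(2) by unfold_locales auto
  then have "subgraph (with_proj ?S) (with_proj G)"
    unfolding subgraph_def using assms by auto
  ultimately show ?thesis unfolding contains_graph_def by blast
qed

lemma contains_fan7:
  assumes wf: "wf_digraph (with_proj G)" and sym: "\<And>u v. (u, v) \<in> parcs G \<Longrightarrow> (v, u) \<in> parcs G"
    and irrefl: "\<And>u. (u, u) \<notin> parcs G"
    and ps: "length ps = 6" "distinct ps" "\<And>i. i < 6 \<Longrightarrow> (c, ps ! i) \<in> parcs G"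
    "\<And>i. i < 5 \<Longrightarrow> (ps ! i, ps ! Suc i) \<in> parcs G"
  shows "contains_graph G fan7"
proof -
  define f where "f = case_sum (\<lambda>_ :: nat. c) (\<lambda>i. ps ! i)"
  have verts: "pverts fan7 = {0} <+> {..<6}"
    by (auto simp: fan7_def graph_join_def complete_graph_def path_graph_def)
  have arcs: "parcs fan7 = {(Inr i, Inr j) | i j. i < 6 \<and> j < 6 \<and> (j = Suc i \<or> i = Suc j)}
      \<union> {(Inl 0, Inr i) | i. i < 6} \<union> {(Inr i, Inl 0) | i. i < 6}"
    by (auto simp: fan7_def graph_join_def complete_graph_def path_graph_def map_prod_def image_iff)
  have c: "c \<noteq> ps ! i" if "i < 6" for i using ps(3)[OF that] irrefl by metis
  have V: "(u, v) \<in> parcs G \<Longrightarrow> u \<in> pverts G \<and> v \<in> pverts G" for u v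
    using wf_digraph.tail_in_verts[OF wf, of "(u, v)"] wf_digraph.head_in_verts[OF wf, of "(u, v)"] by simp
  show ?thesis
  proof (rule contains_graphI[OF wf, of _ f])
    show "parcs fan7 \<subseteq> pverts fan7 \<times> pverts fan7" unfolding verts arcs by auto
    show "inj_on f (pverts fan7)"
    proof (rule inj_onI)
      fix p q assume "p \<in> pverts fan7" "q \<in> pverts fan7" "f p = f q"
      then show "p = q" using c c[symmetric] ps(1,2) unfolding verts f_def
        by (cases p; cases q) (simp_all add: nth_eq_iff_index_eq Plus_def image_iff)
    qed
    show "f ` pverts fan7 \<subseteq> pverts G"
      unfolding verts f_def using V ps(3) by fastforce
    show "map_prod f f ` parcs fan7 \<subseteq> parcs G"
      unfolding arcs f_def using ps(3,4) sym by auto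
  qed
qed

text \<open>Without loops, each edge is the image of exactly two arcs.\<close>

lemma (in pair_graph) card_parcs: "card (parcs G) = 2 * graph_size G"
proof -
  have sym: "(v, u) \<in> parcs G" if "(u, v) \<in> parcs G" for u v
    using pair_sym_arcs that by (auto simp: symmetric_def dest: symD)
  have "card {a \<in> parcs G. (case a of (u, v) \<Rightarrow> {u, v}) = e} = 2" if "e \<in> edges G" for e
  proof -
    obtain u v where uv: "(u, v) \<in> parcs G" "e = {u, v}" using \<open>e \<in> edges G\<close> by (auto simp: edges_def)
    have "u \<noteq> v" using pair_no_loops[OF uv(1)] by simp
    have "{a \<in> parcs G. (case a of (u, v) \<Rightarrow> {u, v}) = e} = {(u, v), (v, u)}"
      using uv sym by (auto simp: doubleton_eq_iff)
    then show ?thesis using \<open>u \<noteq> v\<close> by simp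
  qed
  then have "(\<Sum>e\<in>edges G. card {a \<in> parcs G. (case a of (u, v) \<Rightarrow> {u, v}) = e}) = 2 * card (edges G)"
    by simp
  moreover have "card (parcs G) = (\<Sum>e\<in>edges G. card {a \<in> parcs G. (case a of (u, v) \<Rightarrow> {u, v}) = e})"
    using sum.image_gen[OF pair_finite_arcs, of "\<lambda>_. 1 :: nat" "\<lambda>(u, v). {u, v}"]
    by (simp add: edges_def)
  ultimately show ?thesis by (simp add: graph_size_def)
qed

subsection \<open>The extremal graph\<close>

text \<open>\<open>K_3\<close> joined to \<open>t\<close> isolated vertices, which are encoded as
  \<open>Inr (i, 0)\<close>; \<open>isl\<close> therefore recognises the triangle.\<close>

definition triangle_join :: "nat \<Rightarrow> (nat + nat \<times> nat) pair_pre_digraph" where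
  "triangle_join t = graph_join (complete_graph 3) (graph_copies t (complete_graph 1))"

lemma pverts_triangle_join: "pverts (triangle_join t) = {..<3} <+> {..<t} \<times> {0}"
  by (auto simp: triangle_join_def graph_join_def complete_graph_def graph_copies_def)

lemma parcs_triangle_join:
  "(p, q) \<in> parcs (triangle_join t) \<longleftrightarrow>
    p \<in> pverts (triangle_join t) \<and> q \<in> pverts (triangle_join t) \<and> p \<noteq> q \<and> (isl p \<or> isl q)"
  unfolding pverts_triangle_join
  by (cases p; cases q)
    (auto simp: triangle_join_def graph_join_def complete_graph_def graph_copies_def map_prod_def image_iff)

text \<open>The eigenvector is 1 on the triangle and \<open>3 / k\<close> elsewhere. Rows outside
  the triangle hold by this choice, and a triangle row reads \<open>2 + 3 t / k = k\<close>.\<close>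

lemma eigenvalue_triangle_join:
  assumes fin: "finite (pverts G)" and iso: "graph_iso G (triangle_join t)"
    and k: "k * k = 2 * k + 3 * real t" "k \<noteq> 0"
  shows "eigenvalue (adjacency_matrix G) k"
proof -
  obtain f where f: "inj_on f (pverts G)" "pverts (triangle_join t) = f ` pverts G"
    "parcs (triangle_join t) = map_prod f f ` parcs G" and G: "parcs G \<subseteq> pverts G \<times> pverts G"
    using iso unfolding graph_iso_iff by blast
  define z :: "nat + nat \<times> nat \<Rightarrow> real" where "z = case_sum (\<lambda>_. 1) (\<lambda>_. 3 / k)"
  have bij: "bij_betw f (pverts G) (pverts (triangle_join t))" using f(1,2) by (simp add: bij_betw_def)
  have arcs: "(u, v) \<in> parcs G \<longleftrightarrow> (f u, f v) \<in> parcs (triangle_join t)"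
    if "u \<in> pverts G" "v \<in> pverts G" for u v
  proof
    assume "(u, v) \<in> parcs G"
    then show "(f u, f v) \<in> parcs (triangle_join t)" unfolding f(3) by force
  next
    assume "(f u, f v) \<in> parcs (triangle_join t)"
    then obtain a b where ab: "(a, b) \<in> parcs G" "f u = f a" "f v = f b" unfolding f(3) by auto
    then have "a \<in> pverts G" "b \<in> pverts G" using G by auto
    then have "u = a" "v = b" using inj_onD[OF f(1)] ab(2,3) that by blast+
    then show "(u, v) \<in> parcs G" using ab(1) by simp
  qed
  have row: "(\<Sum>q\<in>pverts (triangle_join t). of_bool ((p, q) \<in> parcs (triangle_join t)) * z q) = k * z p"
    if p: "p \<in> pverts (triangle_join t)" for p
  proof -
    have "(\<Sum>q\<in>pverts (triangle_join t). of_bool ((p, q) \<in> parcs (triangle_join t)) * z q)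
      = (\<Sum>q\<in>pverts (triangle_join t). of_bool (p \<noteq> q \<and> (isl p \<or> isl q)) * z q)"
      using p by (intro sum.cong) (auto simp: parcs_triangle_join)
    also have "\<dots> = (\<Sum>j<3. of_bool (p \<noteq> Inl j \<and> (isl p \<or> isl (Inl j :: nat + nat \<times> nat))))
        + (\<Sum>j\<in>{..<t} \<times> {0}. of_bool (p \<noteq> Inr j \<and> (isl p \<or> isl (Inr j :: nat + nat \<times> nat))) * (3 / k))"
      unfolding pverts_triangle_join by (subst sum.Plus) (auto simp: z_def)
    also have "\<dots> = k * z p"
    proof (cases p)
      case (Inl i)
      then have i: "i < 3" using p by (auto simp: pverts_triangle_join)
      have "(\<Sum>j<3. of_bool (i \<noteq> j)) = (2 :: real)"
        using i by (auto simp: numeral_3_eq_3 lessThan_Suc less_Suc_eq)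
      then show ?thesis using k Inl by (simp add: z_def field_simps)
    next
      case (Inr i)
      then show ?thesis using k by (simp add: z_def)
    qed
    finally show ?thesis .
  qed
  have "(\<Sum>v\<in>pverts G. of_bool ((u, v) \<in> parcs G) * z (f v)) = k * z (f u)" if u: "u \<in> pverts G" for u
  proof -
    have "(\<Sum>v\<in>pverts G. of_bool ((u, v) \<in> parcs G) * z (f v))
        = (\<Sum>v\<in>pverts G. of_bool ((f u, f v) \<in> parcs (triangle_join t)) * z (f v))"
      using u arcs by (intro sum.cong) auto
    also have "\<dots> = (\<Sum>q\<in>pverts (triangle_join t). of_bool ((f u, q) \<in> parcs (triangle_join t)) * z q)"
      using sum.reindex_bij_betw[OF bij] .
    also have "\<dots> = k * z (f u)" using u f(2) by (intro row) auto
    finally show ?thesis .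
  qed
  moreover have "\<exists>v\<in>pverts G. z (f v) \<noteq> 0"
  proof -
    have "Inl 0 \<in> f ` pverts G" unfolding f(2)[symmetric] pverts_triangle_join by auto
    then obtain v where v: "v \<in> pverts G" "Inl 0 = f v" by (rule imageE)
    have "z (f v) = 1" unfolding v(2)[symmetric] by (simp add: z_def)
    then show ?thesis using v(1) by force
  qed
  ultimately show ?thesis unfolding eigenvalue_adjacency_matrix[OF fin] by (intro exI[of _ "z \<circ> f"]) auto
qed

lemma graph_iso_triangle_join:
  assumes fin: "finite (pverts G)" and G: "parcs G \<subseteq> pverts G \<times> pverts G"
    and T: "T \<subseteq> pverts G" "card T = 3"
    and arcs: "\<And>u v. u \<in> pverts G \<Longrightarrow> v \<in> pverts G \<Longrightarrow>
      (u, v) \<in> parcs G \<longleftrightarrow> u \<noteq> v \<and> (u \<in> T \<or> v \<in> T)"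
  shows "graph_iso G (triangle_join (card (pverts G - T)))"
proof -
  let ?J = "triangle_join (card (pverts G - T))"
  obtain g where g: "bij_betw g T {0..<3 :: nat}"
    using ex_bij_betw_finite_nat[OF finite_subset[OF T(1) fin]] T(2) by auto
  obtain h where h: "bij_betw h (pverts G - T) {0 :: nat..<card (pverts G - T)}"
    using ex_bij_betw_finite_nat[of "pverts G - T"] fin by auto
  define f :: "'a \<Rightarrow> nat + nat \<times> nat" where "f v = (if v \<in> T then Inl (g v) else Inr (h v, 0))" for v
  have "inj_on f (pverts G)"
    using bij_betw_imp_inj_on[OF g] bij_betw_imp_inj_on[OF h]
    by (auto simp: f_def inj_on_def split: if_splits)
  moreover have img: "pverts ?J = f ` pverts G"
  proof -
    have "f ` T = Inl ` {0..<3}"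
      unfolding bij_betw_imp_surj_on[OF g, symmetric] by (auto simp: f_def)
    moreover have "f ` (pverts G - T) = Inr ` ({0..<card (pverts G - T)} \<times> {0})"
    proof -
      have "{0..<card (pverts G - T)} \<times> {0} = (\<lambda>v. (h v, 0 :: nat)) ` (pverts G - T)"
        unfolding bij_betw_imp_surj_on[OF h, symmetric] by auto
      then show ?thesis by (auto simp: f_def image_image)
    qed
    moreover have "f ` pverts G = f ` T \<union> f ` (pverts G - T)" using T(1) by blast
    ultimately show ?thesis unfolding pverts_triangle_join by (simp add: Plus_def lessThan_atLeast0)
  qed
  moreover have "parcs ?J = map_prod f f ` parcs G"
  proof -
    have arc: "(f u, f v) \<in> parcs ?J \<longleftrightarrow> (u, v) \<in> parcs G" if "u \<in> pverts G" "v \<in> pverts G" for u v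
    proof -
      have "isl (f w) \<longleftrightarrow> w \<in> T" for w by (simp add: f_def)
      moreover have "f u = f v \<longleftrightarrow> u = v" using inj_on_eq_iff[OF \<open>inj_on f (pverts G)\<close>] that by blast
      ultimately show ?thesis using arcs[OF that] that by (simp add: parcs_triangle_join img)
    qed
    show ?thesis
    proof (intro equalityI subsetI)
      fix e assume e: "e \<in> parcs ?J"
      obtain p q where pq: "e = (p, q)" by (cases e)
      then have "p \<in> f ` pverts G" "q \<in> f ` pverts G"
        using e by (simp_all add: parcs_triangle_join img)
      then obtain u v where "u \<in> pverts G" "v \<in> pverts G" "p = f u" "q = f v" by blast
      then show "e \<in> map_prod f f ` parcs G" using arc[of u v] e pq by force
    next
      fix e assume "e \<in> map_prod f f ` parcs G"
      then obtain u v where "(u, v) \<in> parcs G" "e = (f u, f v)" by auto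
      then show "e \<in> parcs ?J" using arc[of u v] G by auto
    qed
  qed
  ultimately show ?thesis unfolding graph_iso_iff using G by blast
qed

section \<open>The bound and its equality case\<close>

theorem theorem1p1:
  fixes G :: "'a pair_pre_digraph" and m :: nat
  assumes "m \<ge> 33"
    and "pair_graph G"
    and "free_of fan7 G"
    and "graph_size G = m"
    and "no_isolated_vertices G"
  shows "graph_spectral_radius G \<le> 1 + sqrt (real m - 2) \<and>
    (graph_spectral_radius G = 1 + sqrt (real m - 2) \<longleftrightarrow>
      3 dvd m \<and>
      graph_iso G (graph_join (complete_graph 3) (graph_copies ((m - 3) div 3) (complete_graph 1))))"
proof -
  interpret pair_graph G by fact
  let ?V = "pverts G" and ?b = "1 + sqrt (real m - 2)"
  let ?adj = "\<lambda>u v. (u, v) \<in> parcs G"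
  have sym: "?adj v u" if "?adj u v" for u v
    using pair_sym_arcs that by (auto simp: symmetric_def dest: symD)
  have irrefl: "\<not> ?adj u u" for u using pair_no_loops[of "(u, u)"] by auto
  have arcs_V: "parcs G \<subseteq> ?V \<times> ?V" using in_arcsD1 in_arcsD2 by auto
  have wf: "wf_digraph (with_proj G)" using arcs_V by unfold_locales auto
  interpret S: simple_adj ?adj by unfold_locales (use sym irrefl in auto)
  have degree_sum: "S.deg_sum ?V = 2 * m"
  proof -
    have "parcs G = Sigma ?V (\<lambda>v. {u \<in> ?V. ?adj v u})" using arcs_V by auto
    then have "card (parcs G) = card (Sigma ?V (\<lambda>v. {u \<in> ?V. ?adj v u}))" by (rule arg_cong)
    also have "\<dots> = S.deg_sum ?V"
      unfolding S.deg_sum_def S.deg_def using pair_finite_verts by (intro card_SigmaI) auto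
    finally show ?thesis using card_parcs assms(4) by simp
  qed
  have "?V \<noteq> {}" using degree_sum assms(1) by (auto simp: S.deg_sum_def)
  have "\<exists>\<rho> x. (\<forall>v. 0 \<le> x v) \<and> (\<exists>v\<in>?V. x v \<noteq> 0) \<and>
    (\<forall>u\<in>?V. (\<Sum>v\<in>?V. of_bool (?adj u v) * x v) = \<rho> * x u) \<and>
    (\<forall>k y. (\<exists>v\<in>?V. y v \<noteq> 0) \<longrightarrow> (\<forall>u\<in>?V. (\<Sum>v\<in>?V. of_bool (?adj u v) * y v) = k * y u)
      \<longrightarrow> k \<le> (\<rho> :: real))"
    by (rule nonneg_top_eigenvector[OF pair_finite_verts \<open>?V \<noteq> {}\<close>]) 
      (simp_all add: S.adj_commute)
  then obtain \<rho> :: real and x where x: "\<forall>v. 0 \<le> x v" "\<exists>v\<in>?V. x v \<noteq> 0"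
    "\<forall>u\<in>?V. (\<Sum>v\<in>?V. of_bool (?adj u v) * x v) = \<rho> * x u"
    "\<forall>k y. (\<exists>v\<in>?V. y v \<noteq> 0) \<longrightarrow> (\<forall>u\<in>?V. (\<Sum>v\<in>?V. of_bool (?adj u v) * y v) = k * y u)
      \<longrightarrow> k \<le> \<rho>"
    by blast
  have radius: "graph_spectral_radius G = \<rho>"
  proof (rule graph_spectral_radius_eqI[OF pair_finite_verts])
    show "eigenvalue (adjacency_matrix G) \<rho>"
      unfolding eigenvalue_adjacency_matrix[OF pair_finite_verts] using x(2,3) by blast
    show "l \<le> \<rho>" if "eigenvalue (adjacency_matrix G) l" for l
      using that x(4) unfolding eigenvalue_adjacency_matrix[OF pair_finite_verts] by blast
  qed
  \<comment> \<open>This gives both the bound and the forward direction of the equality case: a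
    radius of at least \<open>?b\<close> is exactly \<open>?b\<close>.\<close>
  have extremal: "\<rho> = ?b \<and> 3 dvd m \<and> graph_iso G (triangle_join ((m - 3) div 3))" if "?b \<le> \<rho>"
  proof -
    obtain u0 where u0: "u0 \<in> ?V" "\<And>v. v \<in> ?V \<Longrightarrow> x v \<le> x u0"
    proof -
      have "Max (x ` ?V) \<in> x ` ?V" using pair_finite_verts \<open>?V \<noteq> {}\<close> by (intro Max_in) auto
      then obtain u0 where "u0 \<in> ?V" "x u0 = Max (x ` ?V)" by auto
      moreover have "x v \<le> Max (x ` ?V)" if "v \<in> ?V" for v
        using pair_finite_verts that by (intro Max_ge) auto
      ultimately show ?thesis using that by simp
    qed
    obtain v where "v \<in> ?V" "x v \<noteq> 0" using x(2) by blast
    then have pos: "0 < x u0" using x(1)[rule_format, of v] u0(2)[of v] by linarith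
    \<comment> \<open>Dividing by the largest entry normalises the eigenvector to 1 at
      \<open>u0\<close>.\<close>
    have scaled: "(\<Sum>v\<in>?V. of_bool (?adj u v) * (x v / x u0)) = \<rho> * (x u / x u0)" if "u \<in> ?V" for u
      using x(3) that by (simp add: sum_divide_distrib[symmetric])
    interpret E: extremal_graph ?adj ?V "\<lambda>v. x v / x u0" \<rho> u0 m
    proof unfold_locales
      fix c p1 p2 p3 p4 p5 p6
      assume ps: "distinct [p1, p2, p3, p4, p5, p6]"
        "?adj c p1" "?adj c p2" "?adj c p3" "?adj c p4" "?adj c p5" "?adj c p6"
        "?adj p1 p2" "?adj p2 p3" "?adj p3 p4" "?adj p4 p5" "?adj p5 p6"
      have "?adj c ([p1, p2, p3, p4, p5, p6] ! i)" if "i < 6" for i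
        using that ps by (auto simp: less_Suc_eq numeral_eq_Suc)
      moreover have "?adj ([p1, p2, p3, p4, p5, p6] ! i) ([p1, p2, p3, p4, p5, p6] ! Suc i)" if "i < 5" for i
        using that ps by (auto simp: less_Suc_eq numeral_eq_Suc)
      ultimately have "contains_graph G fan7"
        using ps(1) by (intro contains_fan7[OF wf sym irrefl, of "[p1, p2, p3, p4, p5, p6]" c]) auto
      then show False using assms(3) by (simp add: free_of_def)
    qed (use pair_finite_verts in_arcsD1 assms(1,5) degree_sum u0 pos x(1) scaled that
        in \<open>auto simp: no_isolated_vertices_def\<close>)
    obtain T where T: "T \<subseteq> ?V" "card T = 3"
      "\<And>u v. u \<in> ?V \<Longrightarrow> v \<in> ?V \<Longrightarrow> ?adj u v \<longleftrightarrow> u \<noteq> v \<and> (u \<in> T \<or> v \<in> T)"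
      using E.tight_structure by blast
    define t where "t = card (?V - T)"
    have fin: "finite T" "finite (?V - T)" using finite_subset[OF T(1) pair_finite_verts] pair_finite_verts by auto
    have "card ?V = t + 3" using T(1,2) fin pair_finite_verts card_mono[OF pair_finite_verts T(1)]
      by (simp add: t_def card_Diff_subset)
    have "S.deg ?V u = t + 2" if "u \<in> T" for u
    proof -
      have "{v \<in> ?V. ?adj u v} = ?V - {u}" using T(1,3) that irrefl by auto
      then show ?thesis using that T(1) \<open>card ?V = t + 3\<close> by (auto simp: S.deg_def card_Diff_singleton)
    qed
    moreover have "S.deg ?V u = 3" if "u \<in> ?V - T" for u
    proof -
      have "{v \<in> ?V. ?adj u v} = T" using T(1,3) that by auto
      then show ?thesis using T(2) by (simp add: S.deg_def)
    qed
    moreover have "S.deg_sum ?V = sum (S.deg ?V) (?V - T) + sum (S.deg ?V) T"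
      unfolding S.deg_sum_def using sum.subset_diff[OF T(1) pair_finite_verts] .
    \<comment> \<open>Three vertices of degree \<open>t + 2\<close> and \<open>t\<close> of degree 3
      give \<open>m = 3 t + 3\<close>, hence divisibility by 3.\<close>
    ultimately have "2 * m = t * 3 + 3 * (t + 2)" using degree_sum T(2) by (simp add: t_def)
    then have "m = 3 * t + 3" by simp
    then show ?thesis
      using E.tight(5) graph_iso_triangle_join[OF pair_finite_verts arcs_V T] by (simp add: t_def[symmetric])
  qed
  have attained: "?b \<le> \<rho>" if "3 dvd m" "graph_iso G (triangle_join ((m - 3) div 3))"
  proof -
    obtain t where t: "m = 3 * t" using \<open>3 dvd m\<close> by (elim dvdE)
    then have "(m - 3) div 3 = t - 1" "1 \<le> t" using assms(1) by auto
    then have "3 * real ((m - 3) div 3) = real m - 3" using t by (simp add: of_nat_diff)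
    moreover have "sqrt (real m - 2) * sqrt (real m - 2) = real m - 2" using assms(1) by simp
    \<comment> \<open>\<open>?b\<close> is a root of \<open>k * k = 2 * k + (m - 3)\<close>. It is
      enough that \<open>?b\<close> is some eigenvalue, since \<open>\<rho>\<close> bounds them
      all.\<close>
    ultimately have "?b * ?b = 2 * ?b + 3 * real ((m - 3) div 3)" by (simp add: algebra_simps)
    moreover have "?b \<noteq> 0" using real_sqrt_ge_zero[of "real m - 2"] assms(1) by linarith
    ultimately have "eigenvalue (adjacency_matrix G) ?b"
      by (rule eigenvalue_triangle_join[OF pair_finite_verts that(2)])
    then show ?thesis using x(4) unfolding eigenvalue_adjacency_matrix[OF pair_finite_verts] by blast
  qed
  show ?thesis
    unfolding radius triangle_join_def[symmetric]
  proof (intro conjI iffI)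
    show "\<rho> \<le> ?b" using extremal by (cases "?b \<le> \<rho>") simp_all
    then show "3 dvd m \<and> graph_iso G (triangle_join ((m - 3) div 3)) \<Longrightarrow> \<rho> = ?b"
      using attained by (intro antisym) auto
  qed (use extremal in simp_all)
qed

end
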